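(* For fixed $d \ge 1$, as $n \to \infty$ the expected number $\mathcal{I}_{d,n}$ of interior generators after $n$ observations in dimension $d$ satisfies $$\mathcal{I}_{d,n} = (\ln n)^{d-1} \sum_{j=0}^{d-1} \frac{(-1)^j \Gamma^{(j)}(d)}{j!\,(d-1-j)!} (\ln n)^{-j} + O\big(n^{-1}(\ln n)^{d-1}\big),$$ where $\Gamma^{(j)}$ denotes the $j$-th derivative of the Gamma function.
   Context: Let $X^{(1)}, X^{(2)}, \dots$ be i.i.d. random vectors uniformly distributed on $[0,1)^d$. For $x,y\in\mathbb{R}^d$, $x \prec y$ means $x_j<y_j$ for all $j$ and $x \le y$ means $x_j \le y_j$ for all $j$. After $n$ observations, the record-setting region is $S_n := \{x \in [0,1)^d : x \not\prec X^{(i)} \text{ for all } i \in [n]\}$; its generators are the minimal elements of $S_n$ with respect to $\le$; a generator is interior if all its coordinates are nonzero. $\mathcal{I}_{d,n}$ is the expected number of interior generators of $S_n$. *)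

theory Defs
  imports "HOL-Probability.Probability" "HOL-Library.Landau_Symbols"
begin

definition unit_cube :: "nat \<Rightarrow> (nat \<Rightarrow> real) set" where
  "unit_cube d = PiE {..<d} (\<lambda>_. {0..<1})"

definition sdom :: "nat \<Rightarrow> (nat \<Rightarrow> real) \<Rightarrow> (nat \<Rightarrow> real) \<Rightarrow> bool" where
  "sdom d x y \<longleftrightarrow> (\<forall>j<d. x j < y j)"

definition wdom :: "nat \<Rightarrow> (nat \<Rightarrow> real) \<Rightarrow> (nat \<Rightarrow> real) \<Rightarrow> bool" where
  "wdom d x y \<longleftrightarrow> (\<forall>j<d. x j \<le> y j)"

definition record_region :: "nat \<Rightarrow> nat \<Rightarrow> (nat \<Rightarrow> nat \<Rightarrow> real) \<Rightarrow> (nat \<Rightarrow> real) set" where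
  "record_region d n X = {x \<in> unit_cube d. \<forall>i<n. \<not> sdom d x (X i)}"

definition generators :: "nat \<Rightarrow> nat \<Rightarrow> (nat \<Rightarrow> nat \<Rightarrow> real) \<Rightarrow> (nat \<Rightarrow> real) set" where
  "generators d n X = {x \<in> record_region d n X.
      \<forall>y \<in> record_region d n X. wdom d y x \<longrightarrow> y = x}"

definition interior_generators :: "nat \<Rightarrow> nat \<Rightarrow> (nat \<Rightarrow> nat \<Rightarrow> real) \<Rightarrow> (nat \<Rightarrow> real) set" where
  "interior_generators d n X = {x \<in> generators d n X. \<forall>j<d. x j \<noteq> 0}"

definition unif_cube :: "nat \<Rightarrow> (nat \<Rightarrow> real) measure" where
  "unif_cube d = Pi\<^sub>M {..<d} (\<lambda>_. uniform_measure lborel {0..<1::real})"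

definition sample_space :: "nat \<Rightarrow> nat \<Rightarrow> (nat \<Rightarrow> nat \<Rightarrow> real) measure" where
  "sample_space d n = Pi\<^sub>M {..<n} (\<lambda>_. unif_cube d)"

definition expected_interior_generators :: "nat \<Rightarrow> nat \<Rightarrow> real" where
  "expected_interior_generators d n =
     (\<integral>X. real (card (interior_generators d n X)) \<partial>sample_space d n)"

end

theory Submission
  imports Defs "HOL-Complex_Analysis.Complex_Analysis" "HOL-Real_Asymp.Real_Asymp"
begin

text \<open>
  An interior generator $x$ has, for each coordinate $j$, an observation attaining $x_j$ and strictly
  exceeding $x$ in every other coordinate. Summing over the tuples of these observations, and treating
  the condition that no observation strictly dominates $x$ by inclusion-exclusion, each term is the
  probability that in every one of the $d$ independent columns of the sample a prescribed entry is the
  strict minimum among $d + k$ entries, that is $(d + k)^{-d}$. With $m = n - d$,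
  \[ \mathcal{I}_{d,n} = \frac{n!}{m!} \sum_{k \le m} (-1)^k {m \choose k} (d + k)^{-d}
     = \frac{(-1)^{d-1}}{(d-1)!} F_n^{(d-1)}(d), \quad F_n(s) = \frac{n!}{s (s+1) \cdots (s+m)}, \]
  by partial fractions. On $|s - d| \le 1/2$ one has $F_n(s) = \Gamma(s)\, n^{d-s} (1 + O(1/n))$ uniformly.
  The main term is the $(d-1)$-st derivative of $\Gamma(s)\, n^{d-s}$ at $d$ by the Leibniz rule; for the
  error term, Cauchy's inequality on the circle of radius $1/\ln n$, where $|n^{d-s}| \le e$, costs only
  a factor $(\ln n)^{d-1}$.
\<close>

section \<open>Interior generators as corners of tuples of observations\<close>

text \<open>Restricted to \<open>{..<d}\<close> because the points of \<open>unit_cube d\<close> are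
  extensional functions.\<close>

definition corner :: "nat \<Rightarrow> (nat \<Rightarrow> nat \<Rightarrow> real) \<Rightarrow> (nat \<Rightarrow> nat) \<Rightarrow> nat \<Rightarrow> real" where
  "corner d X \<tau> = (\<lambda>j\<in>{..<d}. X (\<tau> j) j)"

text \<open>The first conjunct makes observation \<open>\<tau> j\<close> exceed the corner in every
  coordinate but j; the second forbids an observation strictly above the corner. Only entries of the
  same column j are compared, so the event depends on the relative order within each column. The
  bounds 0 and 1 on the corner are kept apart, as they hold almost surely.\<close>

definition spans_corner :: "nat \<Rightarrow> nat \<Rightarrow> (nat \<Rightarrow> nat \<Rightarrow> real) \<Rightarrow> (nat \<Rightarrow> nat) \<Rightarrow> bool" where
  "spans_corner d n X \<tau> \<longleftrightarrow>
     (\<forall>j<d. \<forall>k<d. j \<noteq> k \<longrightarrow> X (\<tau> j) j < X (\<tau> k) j) \<and> (\<forall>i<n. \<exists>j<d. X i j \<le> X (\<tau> j) j)"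

text \<open>
  Valid for every sample, not only in general position: \<^term>\<open>sample_space d n\<close> is not complete, so
  measurability of the number of interior generators needs a description without exceptional null set.
\<close>
lemma interior_generators_eq_corners:
  "interior_generators d n X = corner d X `
     {\<tau> \<in> {..<d} \<rightarrow>\<^sub>E {..<n}. (\<forall>j<d. 0 < X (\<tau> j) j \<and> X (\<tau> j) j < 1) \<and> spans_corner d n X \<tau>}"
  (is "?G = corner d X ` ?T")
proof (intro subset_antisym subsetI)
  fix x assume x: "x \<in> ?G"
  then have cube: "x \<in> unit_cube d" and rec: "\<And>i. i < n \<Longrightarrow> \<not> sdom d x (X i)"
    and min: "\<And>y. y \<in> record_region d n X \<Longrightarrow> wdom d y x \<Longrightarrow> y = x"
    and nz: "\<And>j. j < d \<Longrightarrow> x j \<noteq> 0"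
    by (auto simp: interior_generators_def generators_def record_region_def)
  have x01: "0 < x j" "x j < 1" if "j < d" for j
    using cube nz[OF that] that by (auto simp: unit_cube_def PiE_def Pi_def less_le)
  have "\<exists>i<n. X i j = x j \<and> (\<forall>k<d. k \<noteq> j \<longrightarrow> x k < X i k)" if j: "j < d" for j
  proof -
    \<comment> \<open>Lower $x_j$ to the next smaller observed value; minimality then yields an observation above.\<close>
    define F where "F = insert 0 {X i j |i. i < n \<and> X i j < x j}"
    have fin: "finite F" by (auto simp: F_def)
    have ne: "F \<noteq> {}" by (auto simp: F_def)
    define t where "t = Max F"
    have "t \<in> F" unfolding t_def using fin ne by (rule Max_in)
    \<comment> \<open>The value 0 was put into \<open>F\<close> to keep \<open>y\<close> in the
      cube; that it too lies below \<open>x j\<close> is where interiority of the generator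
      enters.\<close>
    then have t: "t < x j" using x01[OF j] by (auto simp: F_def)
    have t0: "0 \<le> t" unfolding t_def using fin by (rule Max_ge) (auto simp: F_def)
    have tmax: "X i j \<le> t" if "i < n" "X i j < x j" for i
      unfolding t_def using fin by (rule Max_ge) (use that in \<open>auto simp: F_def\<close>)
    define y where "y = x(j := t)"
    have "y \<in> unit_cube d" using cube t t0 x01[OF j] j
      by (auto simp: unit_cube_def y_def PiE_def Pi_def extensional_def)
    moreover have "wdom d y x" using t by (auto simp: wdom_def y_def)
    moreover have "y \<noteq> x" using t by (auto simp: y_def fun_eq_iff)
    ultimately obtain i where i: "i < n" "sdom d y (X i)"
      using min[of y] by (auto simp: record_region_def)
    have gt: "x k < X i k" if "k < d" "k \<noteq> j" for k
      using i(2) that by (auto simp: sdom_def y_def dest!: spec[of _ k])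
    have "t < X i j" using i(2) j by (auto simp: sdom_def y_def)
    \<comment> \<open>Observed values below \<open>x j\<close> are at most \<open>t\<close>, so this
      one cannot be below \<open>x j\<close>; were it above, observation i would strictly dominate
      \<open>x\<close>. Hence it equals \<open>x j\<close>.\<close>
    then have "x j \<le> X i j" using tmax[OF i(1)] by force
    moreover have "X i j \<le> x j"
    proof (rule ccontr)
      assume "\<not> ?thesis"
      then have "sdom d x (X i)" using gt by (force simp: sdom_def)
      then show False using rec i by blast
    qed
    ultimately show ?thesis using gt i by auto
  qed
  then obtain f where f: "\<And>j. j < d \<Longrightarrow> f j < n \<and> X (f j) j = x j \<and> (\<forall>k<d. k \<noteq> j \<longrightarrow> x k < X (f j) k)"
    by metis
  define \<tau> where "\<tau> = restrict f {..<d}"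
  have \<tau>: "\<tau> j < n" "X (\<tau> j) j = x j" "\<And>k. k < d \<Longrightarrow> k \<noteq> j \<Longrightarrow> x k < X (\<tau> j) k" if "j < d" for j
    using f[OF that] that by (auto simp: \<tau>_def)
  have "\<exists>j<d. X i j \<le> X (\<tau> j) j" if "i < n" for i
    using rec[OF that] \<tau>(2) by (auto simp: sdom_def not_less)
  moreover have "\<tau> \<in> {..<d} \<rightarrow>\<^sub>E {..<n}" using \<tau>(1) by (auto simp: \<tau>_def)
  ultimately have "\<tau> \<in> ?T" using \<tau>(2,3) x01 by (auto simp: spans_corner_def)
  moreover have "x = corner d X \<tau>"
    using cube \<tau>(2) by (auto simp: fun_eq_iff corner_def unit_cube_def PiE_def extensional_def)
  ultimately show "x \<in> corner d X ` ?T" by blast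
next
  fix x assume "x \<in> corner d X ` ?T"
  then obtain \<tau> where \<tau>: "\<tau> \<in> ?T" "x = corner d X \<tau>" by blast
  have xj: "x j = X (\<tau> j) j" if "j < d" for j using \<tau> that by (auto simp: corner_def)
  have cube: "x \<in> unit_cube d" using \<tau>
    by (auto simp: corner_def unit_cube_def PiE_def Pi_def extensional_def less_imp_le)
  have rec: "x \<in> record_region d n X"
  proof -
    have "\<not> sdom d x (X i)" if "i < n" for i
    proof -
      have "\<exists>j<d. X i j \<le> X (\<tau> j) j" using \<tau>(1) that by (simp add: spans_corner_def)
      then obtain j where "j < d" "X i j \<le> x j" using xj by metis
      then show ?thesis unfolding sdom_def by (meson not_less)
    qed
    then show ?thesis using cube by (simp add: record_region_def)
  qed
  have "y = x" if y: "y \<in> record_region d n X" "wdom d y x" for y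
  proof (rule ccontr)
    assume "y \<noteq> x"
    moreover have "y \<in> unit_cube d" using y by (auto simp: record_region_def)
    ultimately obtain j where j: "j < d" "y j \<noteq> x j"
      using cube unfolding unit_cube_def by (metis PiE_ext lessThan_iff)
    have "y j < x j" using y j by (force simp: wdom_def)
    \<comment> \<open>In coordinate j this is \<open>y j < x j\<close>; in every other coordinate
      \<open>y\<close> is at most \<open>x\<close>, which observation \<open>\<tau> j\<close>
      strictly exceeds.\<close>
    then have "sdom d y (X (\<tau> j))"
      using y(2) \<tau>(1) xj j unfolding sdom_def wdom_def spans_corner_def
      by simp (metis le_less_trans)
    moreover have "\<tau> j < n" using \<tau>(1) j by auto
    ultimately show False using y(1) by (auto simp: record_region_def)
  qed
  moreover have "x j \<noteq> 0" if "j < d" for j using that \<tau>(1) xj by force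
  ultimately show "x \<in> ?G" using rec by (auto simp: interior_generators_def generators_def)
qed

text \<open>Weighting each element by the reciprocal of the size of its fibre makes every fibre
  contribute 1. The cardinality of an image thus becomes a finite sum over a fixed index
  set.\<close>

lemma card_image_eq_sum_fibres:
  assumes "finite A"
  shows "real (card (f ` A)) = (\<Sum>a\<in>A. 1 / real (card {b\<in>A. f b = f a}))"
proof -
  have "(\<Sum>a\<in>A. 1 / real (card {b\<in>A. f b = f a})) =
        (\<Sum>y\<in>f ` A. \<Sum>a\<in>{a\<in>A. f a = y}. 1 / real (card {b\<in>A. f b = f a}))"
    by (rule sum.image_gen[OF assms])
  also have "\<dots> = (\<Sum>y\<in>f ` A. 1)"
  proof (rule sum.cong[OF refl])
    fix y assume "y \<in> f ` A"
    then have "card {a\<in>A. f a = y} \<noteq> 0" using assms by auto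
    then show "(\<Sum>a\<in>{a\<in>A. f a = y}. 1 / real (card {b\<in>A. f b = f a})) = 1" by simp
  qed
  finally show ?thesis by simp
qed

text \<open>By the fibre weights, the cardinality of a random image is a finite expression in the
  indicators of \<open>P X t\<close> and of the coincidences \<open>g X s = g X t\<close>. The
  codomain of \<open>g\<close> needs no measurable structure.\<close>

lemma borel_measurable_card_image:
  assumes "finite T"
    and P: "\<And>t. t \<in> T \<Longrightarrow> Measurable.pred M (\<lambda>X. P X t)"
    and g: "\<And>s t. s \<in> T \<Longrightarrow> t \<in> T \<Longrightarrow> Measurable.pred M (\<lambda>X. g X s = g X t)"
  shows "(\<lambda>X. real (card (g X ` {t \<in> T. P X t}))) \<in> borel_measurable M"
proof -
  have "real (card (g X ` {t \<in> T. P X t})) =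
    (\<Sum>t\<in>T. if P X t then 1 / (\<Sum>s\<in>T. if P X s \<and> g X s = g X t then 1 else 0) else 0)" for X
    using assms(1)
    by (simp add: card_image_eq_sum_fibres flip: sum.inter_filter)
  moreover have "(\<lambda>X. \<Sum>t\<in>T. if P X t then 1 / (\<Sum>s\<in>T. if P X s \<and> g X s = g X t then 1 else 0) else (0::real))
      \<in> borel_measurable M"
    using P g by measurable
  ultimately show ?thesis by simp
qed

section \<open>Columns of the sample\<close>

definition unif01 :: "real measure" where
  "unif01 = uniform_measure lborel {0..<1}"

lemma space_unif01 [simp]: "space unif01 = UNIV"
  and sets_unif01 [measurable_cong, simp]: "sets unif01 = sets borel"
  by (auto simp: unif01_def)

interpretation unif01: prob_space unif01
  unfolding unif01_def by (rule prob_space_uniform_measure) auto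

lemma AE_unif01: "AE x in unif01. 0 < x \<and> x < 1"
  unfolding unif01_def using AE_lborel_singleton[of 0]
  by (intro AE_uniform_measureI) (auto elim!: eventually_mono)

lemma emeasure_unif01_greaterThan:
  assumes "0 \<le> y" "y \<le> 1"
  shows "emeasure unif01 {y<..} = ennreal (1 - y)"
proof -
  have "emeasure unif01 {y<..} = emeasure lborel ({0..<1} \<inter> {y<..}) / emeasure lborel {0..<1::real}"
    unfolding unif01_def by (rule emeasure_uniform_measure) auto
  also have "{0..<1} \<inter> {y<..} = {y<..<1}" using assms by auto
  finally show ?thesis using assms by (simp add: divide_ennreal_def)
qed

text \<open>Fubini with coordinate a taken last: given \<open>\<omega> a = y\<close>, the entries in
  \<open>L\<close> exceed y independently, with probability \<open>(1 - y) ^ card L\<close>, and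
  integrating over y gives the claim.\<close>

lemma emeasure_strict_min_PiM_unif01:
  assumes "finite I" "a \<in> I" "L \<subseteq> I" "a \<notin> L"
  shows "emeasure (PiM I (\<lambda>_. unif01)) {\<omega> \<in> space (PiM I (\<lambda>_. unif01)). \<forall>i\<in>L. \<omega> a < \<omega> i}
         = ennreal (1 / real (Suc (card L)))"
proof -
  interpret product_prob_space "\<lambda>_. unif01" I by standard
  define J where "J = I - {a}"
  have J: "finite J" "a \<notin> J" "I = insert a J" "L \<subseteq> J" using assms by (auto simp: J_def)
  have finL: "finite L" using assms finite_subset by blast
  define E where "E = {\<omega> \<in> space (PiM I (\<lambda>_. unif01)). \<forall>i\<in>L. \<omega> a < \<omega> i}"
  have [measurable]: "E \<in> sets (PiM I (\<lambda>_. unif01))"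
    unfolding E_def using assms finL by measurable (use assms in auto)
  have "emeasure (PiM I (\<lambda>_. unif01)) E = (\<integral>\<^sup>+\<omega>. indicator E \<omega> \<partial>PiM (insert a J) (\<lambda>_. unif01))"
    by (subst J(3)[symmetric]) simp
  also have "\<dots> = (\<integral>\<^sup>+y. (\<integral>\<^sup>+x. indicator E (x(a := y)) \<partial>PiM J (\<lambda>_. unif01)) \<partial>unif01)"
    using J by (intro product_nn_integral_insert_rev) (auto simp flip: J(3))
  also have "\<dots> = (\<integral>\<^sup>+y. emeasure unif01 {y<..} ^ card L \<partial>unif01)"
  proof (rule nn_integral_cong)
    fix y :: real
    have "(\<integral>\<^sup>+x. indicator E (x(a := y)) \<partial>PiM J (\<lambda>_. unif01)) =
          (\<integral>\<^sup>+x. indicator (PiE J (\<lambda>i. if i \<in> L then {y<..} else UNIV)) x \<partial>PiM J (\<lambda>_. unif01))"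
    proof (rule nn_integral_cong)
      fix x assume "x \<in> space (PiM J (\<lambda>_. unif01))"
      then have x: "x \<in> extensional J" by (auto simp: space_PiM PiE_def)
      then have "x(a := y) \<in> space (PiM I (\<lambda>_. unif01))" using J by (auto simp: space_PiM PiE_def extensional_def)
      moreover have "(x(a := y)) i = x i" if "i \<in> L" for i using that assms by auto
      ultimately show "indicator E (x(a := y)) =
          (indicator (PiE J (\<lambda>i. if i \<in> L then {y<..} else UNIV)) x :: ennreal)"
        using x J by (auto simp: E_def PiE_def Pi_def indicator_def split: if_splits)
    qed
    also have "\<dots> = emeasure (PiM J (\<lambda>_. unif01)) (PiE J (\<lambda>i. if i \<in> L then {y<..} else UNIV))"
      using J by (intro nn_integral_indicator sets_PiM_I_finite) auto
    also have "\<dots> = (\<Prod>i\<in>J. emeasure unif01 (if i \<in> L then {y<..} else UNIV))"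
      using J by (intro emeasure_PiM) auto
    also have "\<dots> = (\<Prod>i\<in>J. if i \<in> L then emeasure unif01 {y<..} else 1)"
      using unif01.emeasure_space_1 by (intro prod.cong) auto
    also have "\<dots> = (\<Prod>i\<in>L. emeasure unif01 {y<..})"
      using J by (simp add: prod.If_cases Int_absorb1 inf_commute)
    finally show "(\<integral>\<^sup>+x. indicator E (x(a := y)) \<partial>PiM J (\<lambda>_. unif01)) = emeasure unif01 {y<..} ^ card L"
      by simp
  qed
  also have "\<dots> = (\<integral>\<^sup>+y. ennreal ((1 - y) ^ card L) \<partial>unif01)"
  proof (rule nn_integral_cong_AE)
    show "AE y in unif01. emeasure unif01 {y<..} ^ card L = ennreal ((1 - y) ^ card L)"
      using AE_unif01 by eventually_elim (simp add: emeasure_unif01_greaterThan ennreal_power)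
  qed
  also have "\<dots> = (\<integral>\<^sup>+y. ennreal ((1 - y) ^ card L) * indicator {0..<1} y \<partial>lborel)"
    unfolding unif01_def by (subst nn_integral_uniform_measure) (auto simp: divide_ennreal_def)
  also have "\<dots> = (\<integral>\<^sup>+y. ennreal ((1 - y) ^ card L) * indicator {0..1} y \<partial>lborel)"
    by (rule nn_integral_cong_AE)
       (use AE_lborel_singleton[of 1] in \<open>auto elim!: eventually_mono split: split_indicator\<close>)
  also have "\<dots> = - ((1 - 1) ^ Suc (card L) / real (Suc (card L))) - - ((1 - 0) ^ Suc (card L) / real (Suc (card L)))"
    by (rule nn_integral_FTC_Icc)
       (auto intro!: derivative_eq_intros simp del: power_Suc of_nat_Suc simp: divide_simps)
  also have "\<dots> = ennreal (1 / real (Suc (card L)))" by simp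
  finally show ?thesis by (simp add: E_def)
qed

text \<open>Each of the two strict orders has probability 1/2 by the preceding lemma with a
  singleton \<open>L\<close>, which leaves probability 0 for a tie.\<close>

lemma AE_PiM_unif01_distinct:
  assumes "finite I" "a \<in> I" "b \<in> I" "a \<noteq> b"
  shows "AE \<omega> in PiM I (\<lambda>_. unif01). \<omega> a \<noteq> \<omega> b"
proof -
  interpret product_prob_space "\<lambda>_. unif01" I by standard
  let ?N = "PiM I (\<lambda>_. unif01)"
  define A where "A = {\<omega> \<in> space ?N. \<omega> a < \<omega> b}"
  define B where "B = {\<omega> \<in> space ?N. \<omega> b < \<omega> a}"
  have [measurable]: "A \<in> sets ?N" "B \<in> sets ?N"
    unfolding A_def B_def using assms by measurable
  have "emeasure ?N A = ennreal (1/2)" "emeasure ?N B = ennreal (1/2)"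
    using emeasure_strict_min_PiM_unif01[of I a "{b}"] emeasure_strict_min_PiM_unif01[of I b "{a}"] assms
    unfolding A_def B_def by simp_all
  then have "prob A = 1/2" "prob B = 1/2" by (simp_all only: measure_eq_emeasure_eq_ennreal)
  moreover have "A \<inter> B = {}" by (auto simp: A_def B_def)
  ultimately have "prob (A \<union> B) = 1" by (subst finite_measure_Union) auto
  then have "AE \<omega> in ?N. \<omega> \<in> A \<union> B" by (intro AE_in_set_eq_1[THEN iffD2]) auto
  then show ?thesis by eventually_elim (auto simp: A_def B_def)
qed

lemma measurable_PiM_PiM_component:
  assumes "i \<in> I" "j \<in> J"
  shows "(\<lambda>X. X i j) \<in> PiM I (\<lambda>_. PiM J (\<lambda>_. M)) \<rightarrow>\<^sub>M M"
proof -
  have "(\<lambda>X. X i) \<in> PiM I (\<lambda>_. PiM J (\<lambda>_. M)) \<rightarrow>\<^sub>M PiM J (\<lambda>_. M)"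
    using assms by (intro measurable_component_singleton)
  moreover have "(\<lambda>x. x j) \<in> PiM J (\<lambda>_. M) \<rightarrow>\<^sub>M M"
    using assms by (intro measurable_component_singleton)
  ultimately show ?thesis by (rule measurable_compose)
qed

text \<open>
  Both iterated products are compared with the product over $I \times J$, since the uniqueness rule for
  product measures only tests boxes and a box of column events is not a box of row events.
\<close>
lemma distr_PiM_transpose:
  assumes "finite I" "finite J" "prob_space M"
  shows "distr (PiM J (\<lambda>_. PiM I (\<lambda>_. M))) (PiM I (\<lambda>_. PiM J (\<lambda>_. M))) (\<lambda>\<omega>. \<lambda>i\<in>I. \<lambda>j\<in>J. \<omega> j i)
         = PiM I (\<lambda>_. PiM J (\<lambda>_. M))" 
proof -
  interpret M: prob_space M by fact
  interpret PI: prob_space "PiM I (\<lambda>_. M)" by (intro prob_space_PiM assms)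
  interpret PJ: prob_space "PiM J (\<lambda>_. M)" by (intro prob_space_PiM assms)
  interpret M': product_sigma_finite "\<lambda>_. M" by standard
  interpret PI': product_sigma_finite "\<lambda>_. PiM I (\<lambda>_. M)" by standard
  interpret PJ': product_sigma_finite "\<lambda>_. PiM J (\<lambda>_. M)" by standard
  let ?IJ = "PiM I (\<lambda>_. PiM J (\<lambda>_. M))" and ?JI = "PiM J (\<lambda>_. PiM I (\<lambda>_. M))"
  let ?N = "PiM (I \<times> J) (\<lambda>_. M)"
  let ?u = "\<lambda>\<omega>. \<lambda>p\<in>I \<times> J. \<omega> (fst p) (snd p)" and ?v = "\<lambda>\<omega>. \<lambda>p\<in>I \<times> J. \<omega> (snd p) (fst p)"
  let ?c = "\<lambda>\<omega>. \<lambda>i\<in>I. \<lambda>j\<in>J. \<omega> (i, j)"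
  have u [measurable]: "?u \<in> ?IJ \<rightarrow>\<^sub>M ?N"
    by (intro measurable_restrict measurable_PiM_PiM_component) auto
  have v [measurable]: "?v \<in> ?JI \<rightarrow>\<^sub>M ?N"
    by (intro measurable_restrict measurable_PiM_PiM_component) auto
  have c [measurable]: "?c \<in> ?N \<rightarrow>\<^sub>M ?IJ"
    by (intro measurable_restrict measurable_component_singleton) auto
  have du: "distr ?IJ ?N ?u = ?N"
  proof (rule M'.PiM_eqI)
    fix A assume A: "\<And>p. p \<in> I \<times> J \<Longrightarrow> A p \<in> sets M"
    have "?u -` PiE (I \<times> J) A \<inter> space ?IJ = PiE I (\<lambda>i. PiE J (\<lambda>j. A (i, j)))"
      using A[THEN sets.sets_into_space] by (auto simp: space_PiM PiE_iff) blast+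
    then show "emeasure (distr ?IJ ?N ?u) (PiE (I \<times> J) A) = (\<Prod>p\<in>I \<times> J. emeasure M (A p))"
      using A assms(1,2)
      by (simp add: emeasure_distr sets_PiM_I_finite PJ'.emeasure_PiM M'.emeasure_PiM prod.cartesian_product)
  qed (use assms in auto)
  have dv: "distr ?JI ?N ?v = ?N"
  proof (rule M'.PiM_eqI)
    fix A assume A: "\<And>p. p \<in> I \<times> J \<Longrightarrow> A p \<in> sets M"
    have "?v -` PiE (I \<times> J) A \<inter> space ?JI = PiE J (\<lambda>j. PiE I (\<lambda>i. A (i, j)))"
      using A[THEN sets.sets_into_space] by (auto simp: space_PiM PiE_iff) blast+
    moreover have "(\<Prod>j\<in>J. \<Prod>i\<in>I. emeasure M (A (i, j))) = (\<Prod>p\<in>I \<times> J. emeasure M (A p))"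
      by (subst prod.swap) (simp add: prod.cartesian_product)
    ultimately show "emeasure (distr ?JI ?N ?v) (PiE (I \<times> J) A) = (\<Prod>p\<in>I \<times> J. emeasure M (A p))"
      using A assms(1,2)
      by (simp add: emeasure_distr sets_PiM_I_finite PI'.emeasure_PiM M'.emeasure_PiM)
  qed (use assms in auto)
  \<comment> \<open>Currying \<open>?c\<close> undoes \<open>?u\<close>, so \<open>?IJ\<close> is
    the image under \<open>?c\<close> of the flat product. That product is also the image of
    \<open>?JI\<close> under \<open>?v\<close>, and \<open>?c\<close> after \<open>?v\<close> is the
    transposition.\<close>
  have "?IJ = distr ?IJ ?IJ (\<lambda>\<omega>. \<omega>)" by simp
  also have "\<dots> = distr ?IJ ?IJ (?c \<circ> ?u)"
    by (intro distr_cong) (auto simp: space_PiM PiE_iff fun_eq_iff extensional_def restrict_def)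
  also have "\<dots> = distr (distr ?IJ ?N ?u) ?IJ ?c" by (rule distr_distr[symmetric]) measurable
  also have "\<dots> = distr (distr ?JI ?N ?v) ?IJ ?c" by (simp only: du dv)
  also have "\<dots> = distr ?JI ?IJ (?c \<circ> ?v)" by (rule distr_distr) measurable
  also have "\<dots> = distr ?JI ?IJ (\<lambda>\<omega>. \<lambda>i\<in>I. \<lambda>j\<in>J. \<omega> j i)"
    by (intro distr_cong) (auto simp: fun_eq_iff restrict_def)
  finally show ?thesis by simp
qed

lemma measurable_PiM_column:
  assumes "j \<in> J"
  shows "(\<lambda>X. \<lambda>i\<in>I. X i j) \<in> PiM I (\<lambda>_. PiM J (\<lambda>_. M)) \<rightarrow>\<^sub>M PiM I (\<lambda>_. M)"
  using assms by (intro measurable_restrict measurable_PiM_PiM_component)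

text \<open>Independence of the columns of the sample. Pulled back along the transposition, the
  event becomes the box \<open>PiE J E\<close> in a product indexed by columns.\<close>

lemma emeasure_PiM_columns:
  assumes "finite I" "finite J" "prob_space M" and E: "\<And>j. j \<in> J \<Longrightarrow> E j \<in> sets (PiM I (\<lambda>_. M))"
  shows "emeasure (PiM I (\<lambda>_. PiM J (\<lambda>_. M)))
           {X \<in> space (PiM I (\<lambda>_. PiM J (\<lambda>_. M))). \<forall>j\<in>J. (\<lambda>i\<in>I. X i j) \<in> E j}
         = (\<Prod>j\<in>J. emeasure (PiM I (\<lambda>_. M)) (E j))" (is "emeasure ?IJ ?A = _")
proof -
  interpret PI: prob_space "PiM I (\<lambda>_. M)" by (intro prob_space_PiM assms)
  interpret PI': product_sigma_finite "\<lambda>_. PiM I (\<lambda>_. M)" by standard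
  let ?JI = "PiM J (\<lambda>_. PiM I (\<lambda>_. M))"
  let ?t = "\<lambda>\<omega>. \<lambda>i\<in>I. \<lambda>j\<in>J. \<omega> j i"
  have t [measurable]: "?t \<in> ?JI \<rightarrow>\<^sub>M ?IJ"
    by (intro measurable_restrict measurable_PiM_PiM_component)
  have [measurable]: "?A \<in> sets ?IJ"
  proof -
    have "{X \<in> space ?IJ. (\<lambda>i\<in>I. X i j) \<in> E j} \<in> sets ?IJ" if "j \<in> J" for j
      using measurable_sets[OF measurable_PiM_column[OF that] E[OF that]]
      by (simp add: vimage_def Int_def conj_commute)
    then show ?thesis using assms by (intro sets.sets_Collect_finite_All) auto
  qed
  have "emeasure ?IJ ?A = emeasure (distr ?JI ?IJ ?t) ?A"
    using distr_PiM_transpose[OF assms(1,2,3)] by simp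
  also have "\<dots> = emeasure ?JI (?t -` ?A \<inter> space ?JI)"
    by (intro emeasure_distr) measurable
  also have "?t -` ?A \<inter> space ?JI = PiE J E"
  proof -
    have *: "(\<lambda>i\<in>I. ?t \<omega> i j) = \<omega> j" if "\<omega> \<in> space ?JI" "j \<in> J" for \<omega> j
      using that by (force simp: space_PiM PiE_iff extensional_def)
    have "?t -` ?A \<inter> space ?JI = {\<omega> \<in> space ?JI. \<forall>j\<in>J. \<omega> j \<in> E j}"
      using measurable_space[OF t] * by auto
    also have "\<dots> = PiE J E"
    proof -
      have "\<omega> j \<in> space (PiM I (\<lambda>_. M))" if "j \<in> J" "\<omega> j \<in> E j" for \<omega> j
        using sets.sets_into_space[OF E[OF that(1)]] that(2) by blast
      then show ?thesis unfolding space_PiM[of J] PiE_def Pi_def by blast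
    qed
    finally show ?thesis .
  qed
  also have "emeasure ?JI (PiE J E) = (\<Prod>j\<in>J. emeasure (PiM I (\<lambda>_. M)) (E j))"
    using assms by (intro PI'.emeasure_PiM) auto
  finally show ?thesis .
qed

text \<open>Transfers null sets from one column to the whole sample: independence of columns is
  applied with the sure event in every column other than j.\<close>

lemma AE_PiM_column:
  assumes "finite I" "finite J" "prob_space M" "j \<in> J"
    and ae: "AE \<omega> in PiM I (\<lambda>_. M). P \<omega>" and meas: "Measurable.pred (PiM I (\<lambda>_. M)) P"
  shows "AE X in PiM I (\<lambda>_. PiM J (\<lambda>_. M)). P (\<lambda>i\<in>I. X i j)"
proof -
  interpret PI: prob_space "PiM I (\<lambda>_. M)" by (intro prob_space_PiM assms)
  interpret IJ: prob_space "PiM I (\<lambda>_. PiM J (\<lambda>_. M))" by (intro prob_space_PiM assms)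
  define E where "E k = (if k = j then {\<omega> \<in> space (PiM I (\<lambda>_. M)). P \<omega>} else space (PiM I (\<lambda>_. M)))" for k
  have E: "E k \<in> sets (PiM I (\<lambda>_. M))" for k
    using meas by (auto simp: E_def pred_def)
  have "emeasure (PiM I (\<lambda>_. M)) (E k) = 1" for k
    using ae AE_space by (intro PI.emeasure_eq_1_AE E) (auto simp: E_def elim!: eventually_elim2)
  then have "emeasure (PiM I (\<lambda>_. PiM J (\<lambda>_. M)))
           {X \<in> space (PiM I (\<lambda>_. PiM J (\<lambda>_. M))). \<forall>j\<in>J. (\<lambda>i\<in>I. X i j) \<in> E j} = 1"
    using emeasure_PiM_columns[OF assms(1-3), of E] E by simp
  then have "IJ.prob {X \<in> space (PiM I (\<lambda>_. PiM J (\<lambda>_. M))). \<forall>j\<in>J. (\<lambda>i\<in>I. X i j) \<in> E j} = 1"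
    by (simp add: measure_def)
  from IJ.AE_prob_1[OF this]
  have "AE X in PiM I (\<lambda>_. PiM J (\<lambda>_. M)). \<forall>j\<in>J. (\<lambda>i\<in>I. X i j) \<in> E j"
    by eventually_elim auto
  then show ?thesis by eventually_elim (use \<open>j \<in> J\<close> in \<open>auto simp: E_def\<close>)
qed

section \<open>Almost sure properties and measurability for the sample\<close>

lemma sample_space_eq: "sample_space d n = PiM {..<n} (\<lambda>_. PiM {..<d} (\<lambda>_. unif01))"
  by (simp add: sample_space_def unif_cube_def unif01_def)

lemma prob_space_sample_space: "prob_space (sample_space d n)"
  unfolding sample_space_eq by (intro prob_space_PiM unif01.prob_space_axioms)

lemma borel_measurable_sample_component:
  assumes "i < n" "j < d"
  shows "(\<lambda>X. X i j) \<in> borel_measurable (sample_space d n)"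
  using measurable_PiM_PiM_component[of i "{..<n}" j "{..<d}" unif01] assms
  by (simp add: sample_space_eq measurable_cong_sets[OF refl sets_unif01])

lemma AE_sample_01: "AE X in sample_space d n. \<forall>i<n. \<forall>j<d. 0 < X i j \<and> X i j < 1"
proof -
  have "AE X in sample_space d n. 0 < X i j \<and> X i j < 1" if ij: "i < n" "j < d" for i j
  proof -
    have "AE x in PiM {..<d} (\<lambda>_. unif01). 0 < x j \<and> x j < 1"
      using ij AE_unif01 unif01.prob_space_axioms
      by (intro AE_PiM_component[where P = "\<lambda>x. 0 < x \<and> x < 1"]) auto
    then show ?thesis unfolding sample_space_eq using ij unif01.prob_space_axioms
      by (intro AE_PiM_component[where P = "\<lambda>x. 0 < x j \<and> x j < 1"] prob_space_PiM) auto
  qed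
  then show ?thesis by (simp add: AE_all_countable)
qed

lemma AE_sample_distinct:
  "AE X in sample_space d n. \<forall>j<d. \<forall>i<n. \<forall>i'<n. i \<noteq> i' \<longrightarrow> X i j \<noteq> X i' j"
proof -
  have "AE X in sample_space d n. X i j \<noteq> X i' j" if *: "j < d" "i < n" "i' < n" "i \<noteq> i'" for i i' j
  proof -
    have meas: "Measurable.pred (PiM {..<n} (\<lambda>_. unif01)) (\<lambda>\<omega>. \<omega> i \<noteq> \<omega> i')"
      unfolding neq_iff using * by (intro pred_intros_logic borel_measurable_pred_less) measurable
    have "AE X in sample_space d n. (\<lambda>i\<in>{..<n}. X i j) i \<noteq> (\<lambda>i\<in>{..<n}. X i j) i'"
      unfolding sample_space_eq
      by (rule AE_PiM_column[where P = "\<lambda>\<omega>. \<omega> i \<noteq> \<omega> i'"])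
         (use * meas in \<open>auto intro!: AE_PiM_unif01_distinct unif01.prob_space_axioms\<close>)
    then show ?thesis using * by simp
  qed
  then show ?thesis by (simp add: AE_all_countable)
qed

lemma pred_spans_corner:
  assumes "\<tau> \<in> {..<d} \<rightarrow>\<^sub>E {..<n}"
  shows "Measurable.pred (sample_space d n) (\<lambda>X. spans_corner d n X \<tau>)"
proof -
  have comp: "(\<lambda>X. X (\<tau> k) j) \<in> borel_measurable (sample_space d n)" if "k < d" "j < d" for k j
    using PiE_mem[OF assms, of k] that by (intro borel_measurable_sample_component) simp_all
  have less: "Measurable.pred (sample_space d n) (\<lambda>X. j \<noteq> k \<longrightarrow> X (\<tau> j) j < X (\<tau> k) j)"
    if "j \<in> {..<d}" "k \<in> {..<d}" for j k
    using that by (intro pred_intros_imp' borel_measurable_pred_less comp) (simp_all only: lessThan_iff)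
  have "Measurable.pred (sample_space d n) (\<lambda>X. \<forall>j\<in>{..<d}. \<forall>k\<in>{..<d}. j \<noteq> k \<longrightarrow> X (\<tau> j) j < X (\<tau> k) j)"
    by (intro pred_intros_finite(3) less finite_lessThan)
  moreover
  have le: "Measurable.pred (sample_space d n) (\<lambda>X. X i j \<le> X (\<tau> j) j)"
    if "i \<in> {..<n}" "j \<in> {..<d}" for i j
    unfolding pred_def using that
    by (intro borel_measurable_le borel_measurable_sample_component comp) (simp_all only: lessThan_iff)
  have "Measurable.pred (sample_space d n) (\<lambda>X. \<forall>i\<in>{..<n}. \<exists>j\<in>{..<d}. X i j \<le> X (\<tau> j) j)"
    by (intro pred_intros_finite(3,4) le finite_lessThan)
  ultimately have "Measurable.pred (sample_space d n) (\<lambda>X.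
      (\<forall>j\<in>{..<d}. \<forall>k\<in>{..<d}. j \<noteq> k \<longrightarrow> X (\<tau> j) j < X (\<tau> k) j) \<and> (\<forall>i\<in>{..<n}. \<exists>j\<in>{..<d}. X i j \<le> X (\<tau> j) j))"
    by (rule pred_intros_logic(3))
  then show ?thesis unfolding spans_corner_def Ball_def Bex_def lessThan_iff .
qed

lemma sum_Pow_card:
  fixes f :: "nat \<Rightarrow> real"
  assumes "finite A"
  shows "(\<Sum>K\<in>Pow A. f (card K)) = (\<Sum>k\<le>card A. real (card A choose k) * f k)"
proof -
  have "(\<Sum>K\<in>Pow A. f (card K)) = (\<Sum>k\<le>card A. \<Sum>K\<in>{K\<in>Pow A. card K = k}. f (card K))"
    using assms by (intro sum.group[symmetric]) (auto intro: card_mono)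
  also have "\<dots> = (\<Sum>k\<le>card A. real (card A choose k) * f k)"
    using n_subsets[OF assms] by (intro sum.cong) (auto simp: Pow_def)
  finally show ?thesis .
qed

section \<open>The expected number of interior generators\<close>

text \<open>In column j the entry of \<open>\<tau> j\<close> must be the strict minimum among the
  \<open>card L\<close> entries indexed by \<open>L\<close>, which has probability
  \<open>1 / card L\<close>; the d columns are independent.\<close>

lemma measure_strict_min_columns:
  assumes \<tau>: "\<tau> \<in> {..<d} \<rightarrow>\<^sub>E {..<n}" and L: "\<tau> ` {..<d} \<subseteq> L" "L \<subseteq> {..<n}"
  defines "D \<equiv> {X \<in> space (sample_space d n). \<forall>j<d. \<forall>i\<in>L - {\<tau> j}. X (\<tau> j) j < X i j}"
  shows "D \<in> sets (sample_space d n)" "measure (sample_space d n) D = (1 / real (card L)) ^ d"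
proof -
  interpret prob_space "sample_space d n" by (rule prob_space_sample_space)
  have finL: "finite L" using L finite_subset by blast
  let ?N = "PiM {..<n} (\<lambda>_. unif01)"
  define E where "E j = {\<omega> \<in> space ?N. \<forall>i\<in>L - {\<tau> j}. \<omega> (\<tau> j) < \<omega> i}" for j
  have \<tau>j: "\<tau> j \<in> L" "\<tau> j < n" if "j < d" for j using \<tau> L that by auto
  have E: "E j \<in> sets ?N" if "j < d" for j
  proof -
    have "Measurable.pred ?N (\<lambda>\<omega>. \<forall>i\<in>L - {\<tau> j}. \<omega> (\<tau> j) < \<omega> i)"
    proof (intro pred_intros_finite(3) borel_measurable_pred_less)
      have comp: "(\<lambda>\<omega>. \<omega> i) \<in> borel_measurable ?N" if "i < n" for i
        using measurable_component_singleton[of i "{..<n}" "\<lambda>_. unif01"] that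
        by (simp add: measurable_cong_sets[OF refl sets_unif01])
      show "(\<lambda>\<omega>. \<omega> (\<tau> j)) \<in> borel_measurable ?N" using \<tau>j[OF that] by (intro comp)
      show "(\<lambda>\<omega>. \<omega> i) \<in> borel_measurable ?N" if "i \<in> L - {\<tau> j}" for i
        using that L by (intro comp) auto
    qed (use finL in auto)
    then show ?thesis unfolding E_def pred_def .
  qed
  have cE: "(\<lambda>i\<in>{..<n}. X i j) \<in> E j \<longleftrightarrow> (\<forall>i\<in>L - {\<tau> j}. X (\<tau> j) j < X i j)" if "j < d" for X j
    using \<tau>j[OF that] L by (auto simp: E_def space_PiM)
  have D_eq: "D = {X \<in> space (sample_space d n). \<forall>j\<in>{..<d}. (\<lambda>i\<in>{..<n}. X i j) \<in> E j}"
    unfolding D_def using cE by auto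
  show "D \<in> sets (sample_space d n)"
  proof -
    have "{X \<in> space (sample_space d n). (\<lambda>i\<in>{..<n}. X i j) \<in> E j} \<in> sets (sample_space d n)" if "j \<in> {..<d}" for j
      using measurable_sets[OF measurable_PiM_column[OF that] E] that
      by (simp add: sample_space_eq vimage_def Int_def conj_commute)
    then show ?thesis unfolding D_eq by (intro sets.sets_Collect_finite_All) auto
  qed
  have "emeasure (sample_space d n) D = (\<Prod>j<d. emeasure ?N (E j))"
    unfolding D_eq sample_space_eq using E by (intro emeasure_PiM_columns unif01.prob_space_axioms) auto
  also have "\<dots> = (\<Prod>j<d. ennreal (1 / real (card L)))"
  proof (rule prod.cong[OF refl])
    fix j assume j: "j \<in> {..<d}"
    then have "card L = Suc (card (L - {\<tau> j}))" using \<tau>j[of j] finL by (simp only: card_Suc_Diff1 lessThan_iff)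
    moreover have "emeasure ?N (E j) = ennreal (1 / real (Suc (card (L - {\<tau> j}))))"
      unfolding E_def using \<tau>j[of j] j L by (intro emeasure_strict_min_PiM_unif01) auto
    ultimately show "emeasure ?N (E j) = ennreal (1 / real (card L))" by simp
  qed
  also have "\<dots> = ennreal ((1 / real (card L)) ^ d)" by (subst prod_constant, subst ennreal_power) auto
  finally show "prob D = (1 / real (card L)) ^ d" by (intro measure_eq_emeasure_eq_ennreal) auto
qed

text \<open>Inclusion-exclusion over the set \<open>R\<close> of observations outside the tuple.
  Requiring all observations in a subset \<open>K\<close> of \<open>R\<close> to dominate the corner
  gives a strict-minimum event on \<open>d + card K\<close> rows, so only the size of
  \<open>K\<close> matters.\<close>

lemma prob_spans_corner:
  assumes \<tau>: "\<tau> \<in> {..<d} \<rightarrow>\<^sub>E {..<n}" and inj: "inj_on \<tau> {..<d}"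
  shows "measure (sample_space d n) {X \<in> space (sample_space d n). spans_corner d n X \<tau>}
         = (\<Sum>k\<le>n - d. (-1) ^ k * real ((n - d) choose k) / real (d + k) ^ d)"
proof -
  interpret prob_space "sample_space d n" by (rule prob_space_sample_space)
  define R where "R = {..<n} - \<tau> ` {..<d}"
  have sub: "\<tau> ` {..<d} \<subseteq> {..<n}" using \<tau> by auto
  have cI: "card (\<tau> ` {..<d}) = d" using inj by (simp add: card_image)
  have cR: "card R = n - d" unfolding R_def using sub cI by (subst card_Diff_subset) auto
  define D where "D K = {X \<in> space (sample_space d n).
      \<forall>j<d. \<forall>i\<in>\<tau> ` {..<d} \<union> K - {\<tau> j}. X (\<tau> j) j < X i j}" for K
  have D: "D K \<in> events" "prob (D K) = (1 / real (d + card K)) ^ d" if "K \<in> Pow R" for K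
  proof -
    have "finite K" using that finite_subset[of K "{..<n}"] by (auto simp: R_def)
    then have card: "card (\<tau> ` {..<d} \<union> K) = d + card K"
      using that cI by (subst card_Un_disjoint) (auto simp: R_def)
    have "\<tau> ` {..<d} \<union> K \<subseteq> {..<n}" using that sub by (auto simp: R_def)
    note mc = measure_strict_min_columns[OF \<tau> Un_upper1 this]
    show "D K \<in> events" unfolding D_def by (rule mc(1))
    show "prob (D K) = (1 / real (d + card K)) ^ d"
      unfolding D_def card[symmetric] by (rule mc(2))
  qed
  have *: "indicator {X \<in> space (sample_space d n). spans_corner d n X \<tau>} X =
      (\<Sum>K\<in>Pow R. (-1) ^ card K * indicator (D K) X :: real)" if "X \<in> space (sample_space d n)" for X
  proof -
    define C where "C \<longleftrightarrow> (\<forall>j<d. \<forall>k<d. j \<noteq> k \<longrightarrow> X (\<tau> j) j < X (\<tau> k) j)"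
    define Q where "Q i \<longleftrightarrow> (\<forall>j<d. X (\<tau> j) j < X i j)" for i
    \<comment> \<open>A member \<open>\<tau> k\<close> of the tuple never dominates the corner,
      since it attains it in coordinate k; only \<open>R\<close> remains to be checked.\<close>
    have "(\<forall>i<n. \<exists>j<d. X i j \<le> X (\<tau> j) j) \<longleftrightarrow> (\<forall>i\<in>R. \<not> Q i)"
    proof
      assume "\<forall>i<n. \<exists>j<d. X i j \<le> X (\<tau> j) j"
      then show "\<forall>i\<in>R. \<not> Q i" unfolding R_def Q_def by (meson DiffD1 lessThan_iff not_less)
    next
      assume *: "\<forall>i\<in>R. \<not> Q i"
      show "\<forall>i<n. \<exists>j<d. X i j \<le> X (\<tau> j) j"
      proof (intro allI impI)
        fix i assume "i < n"
        then consider "i \<in> R" | k where "k < d" "i = \<tau> k" unfolding R_def by blast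
        then show "\<exists>j<d. X i j \<le> X (\<tau> j) j"
        proof cases
          case 1
          with * show ?thesis unfolding Q_def by (meson not_less)
        qed blast
      qed
    qed
    moreover have "(\<Prod>i\<in>R. 1 - of_bool (Q i) :: real) = of_bool (\<forall>i\<in>R. \<not> Q i)"
    proof (cases "\<forall>i\<in>R. \<not> Q i")
      case False
      then show ?thesis by (auto simp: R_def intro!: prod_zero)
    qed simp
    moreover have "X \<in> {X \<in> space (sample_space d n). spans_corner d n X \<tau>} \<longleftrightarrow>
        C \<and> (\<forall>i<n. \<exists>j<d. X i j \<le> X (\<tau> j) j)"
      using that unfolding spans_corner_def C_def by blast
    ultimately have "indicator {X \<in> space (sample_space d n). spans_corner d n X \<tau>} X =
        of_bool C * (\<Prod>i\<in>R. 1 - of_bool (Q i) :: real)"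
      by (simp add: indicator_def)
    \<comment> \<open>Expanding the product over \<open>R\<close> gives one signed term for each
      subset \<open>K\<close> of simultaneous dominations.\<close>
    also have "\<dots> = (\<Sum>K\<in>Pow R. (-1) ^ card K * (of_bool C * (\<Prod>i\<in>K. of_bool (Q i))))"
      by (subst prod_diff_conv_sum) (auto simp: R_def sum_distrib_left mult_ac)
    also have "\<dots> = (\<Sum>K\<in>Pow R. (-1) ^ card K * indicator (D K) X)"
    proof (intro sum.cong refl arg_cong2[where f = "(*)"])
      fix K assume K: "K \<in> Pow R"
      then have finK: "finite K" using finite_subset[of K "{..<n}"] by (auto simp: R_def)
      have "X \<in> D K \<longleftrightarrow> C \<and> (\<forall>i\<in>K. Q i)"
      proof -
        have "X \<in> D K \<longleftrightarrow> (\<forall>j<d. \<forall>i\<in>\<tau> ` {..<d} - {\<tau> j}. X (\<tau> j) j < X i j) \<and>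
                (\<forall>j<d. \<forall>i\<in>K - {\<tau> j}. X (\<tau> j) j < X i j)"
          using that unfolding D_def by blast
        moreover have "(\<forall>j<d. \<forall>i\<in>K - {\<tau> j}. X (\<tau> j) j < X i j) \<longleftrightarrow> (\<forall>i\<in>K. Q i)"
          using K unfolding Q_def R_def by blast
        \<comment> \<open>Injectivity is essential here: removing the row \<open>\<tau> j\<close>
          from the image removes exactly the index j.\<close>
        moreover have "(\<forall>j<d. \<forall>i\<in>\<tau> ` {..<d} - {\<tau> j}. X (\<tau> j) j < X i j) \<longleftrightarrow> C"
          unfolding C_def using inj_onD[OF inj] lessThan_iff by blast
        ultimately show ?thesis by blast
      qed
      moreover have "(\<Prod>i\<in>K. of_bool (Q i)) = (of_bool (\<forall>i\<in>K. Q i) :: real)"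
        using finK by (auto intro!: prod_zero)
      ultimately show "of_bool C * (\<Prod>i\<in>K. of_bool (Q i)) = (indicator (D K) X :: real)"
        by (auto simp: indicator_def)
    qed
    finally show ?thesis .
  qed
  have "prob {X \<in> space (sample_space d n). spans_corner d n X \<tau>} =
      (\<integral>X. indicator {X \<in> space (sample_space d n). spans_corner d n X \<tau>} X \<partial>sample_space d n)"
    using pred_spans_corner[OF \<tau>] by simp
  also have "\<dots> = (\<integral>X. (\<Sum>K\<in>Pow R. (-1) ^ card K * indicator (D K) X) \<partial>sample_space d n)"
    using * by (intro Bochner_Integration.integral_cong) auto
  also have "\<dots> = (\<Sum>K\<in>Pow R. (-1) ^ card K * prob (D K))"
    using D(1) by (subst Bochner_Integration.integral_sum) (auto simp: emeasure_eq_measure)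
  also have "\<dots> = (\<Sum>K\<in>Pow R. (-1) ^ card K * (1 / real (d + card K)) ^ d)"
    using D(2) by simp
  also have "\<dots> = (\<Sum>k\<le>n - d. real ((n - d) choose k) * ((-1) ^ k * (1 / real (d + k)) ^ d))"
    unfolding cR[symmetric] by (rule sum_Pow_card) (auto simp: R_def)
  finally show ?thesis by (simp add: divide_inverse power_inverse mult_ac)
qed

text \<open>A row used for two coordinates j and k would have to satisfy
  \<open>X (\<tau> j) j < X (\<tau> j) j\<close>.\<close>

lemma not_spans_corner:
  assumes "\<not> inj_on \<tau> {..<d}"
  shows "\<not> spans_corner d n X \<tau>"
  using assms by (fastforce simp: inj_on_def spans_corner_def)

text \<open>Almost surely the entries of each column are distinct and lie strictly between 0 and 1.
  Different tuples then have different corners, so the generators are counted by indicators and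
  linearity of expectation applies.\<close>

lemma expected_interior_generators_eq_sum_prob:
  "expected_interior_generators d n = (\<Sum>\<tau>\<in>{..<d} \<rightarrow>\<^sub>E {..<n}.
      measure (sample_space d n) {X \<in> space (sample_space d n). spans_corner d n X \<tau>})"
proof -
  interpret prob_space "sample_space d n" by (rule prob_space_sample_space)
  let ?T = "{..<d} \<rightarrow>\<^sub>E {..<n} :: (nat \<Rightarrow> nat) set"
  have finT: "finite ?T" by (intro finite_PiE) auto
  let ?A = "\<lambda>\<tau>. {X \<in> space (sample_space d n). spans_corner d n X \<tau>}"
  have A: "?A \<tau> \<in> events" if "\<tau> \<in> ?T" for \<tau> using pred_spans_corner[OF that] unfolding pred_def .
  have meas: "(\<lambda>X. real (card (interior_generators d n X))) \<in> borel_measurable (sample_space d n)"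
    unfolding interior_generators_eq_corners
  proof (rule borel_measurable_card_image[OF finT])
    fix \<tau> assume \<tau>: "\<tau> \<in> ?T"
    have comp: "(\<lambda>X. X (\<tau> j) j) \<in> borel_measurable (sample_space d n)" if "j < d" for j
      using \<tau> that by (intro borel_measurable_sample_component) auto
    have "Measurable.pred (sample_space d n) (\<lambda>X. 0 < X (\<tau> j) j \<and> X (\<tau> j) j < 1)" if "j < d" for j
      using borel_measurable_pred_less[OF borel_measurable_const comp[OF that]]
        borel_measurable_pred_less[OF comp[OF that] borel_measurable_const] by (simp add: pred_def)
    then have "Measurable.pred (sample_space d n) (\<lambda>X. \<forall>j\<in>{..<d}. 0 < X (\<tau> j) j \<and> X (\<tau> j) j < 1)"
      by (intro pred_intros_finite(3)) auto
    then show "Measurable.pred (sample_space d n)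
        (\<lambda>X. (\<forall>j<d. 0 < X (\<tau> j) j \<and> X (\<tau> j) j < 1) \<and> spans_corner d n X \<tau>)"
      using pred_spans_corner[OF \<tau>] unfolding Ball_def lessThan_iff by (rule pred_intros_logic(3))
    fix \<sigma> assume \<sigma>: "\<sigma> \<in> ?T"
    have comp': "(\<lambda>X. X (\<sigma> j) j) \<in> borel_measurable (sample_space d n)" if "j < d" for j
      using \<sigma> that by (intro borel_measurable_sample_component) auto
    have "Measurable.pred (sample_space d n) (\<lambda>X. X (\<sigma> j) j = X (\<tau> j) j)" if "j < d" for j
      using comp[OF that] comp'[OF that] by (simp add: pred_def borel_measurable_eq)
    then have "Measurable.pred (sample_space d n) (\<lambda>X. \<forall>j\<in>{..<d}. X (\<sigma> j) j = X (\<tau> j) j)"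
      by (intro pred_intros_finite(3,4)) auto
    also have "(\<lambda>X. \<forall>j\<in>{..<d}. X (\<sigma> j) j = X (\<tau> j) j) = (\<lambda>X. corner d X \<sigma> = corner d X \<tau>)"
      by (intro ext) (auto simp: corner_def fun_eq_iff)
    finally show "Measurable.pred (sample_space d n) (\<lambda>X. corner d X \<sigma> = corner d X \<tau>)" .
  qed
  have "expected_interior_generators d n = (\<integral>X. (\<Sum>\<tau>\<in>?T. indicator (?A \<tau>) X) \<partial>sample_space d n)"
    unfolding expected_interior_generators_def
  proof (rule integral_cong_AE[OF meas])
    show "(\<lambda>X. \<Sum>\<tau>\<in>?T. indicator (?A \<tau>) X :: real) \<in> borel_measurable (sample_space d n)"
      using A by (intro borel_measurable_sum borel_measurable_indicator) auto
    show "AE X in sample_space d n. real (card (interior_generators d n X)) = (\<Sum>\<tau>\<in>?T. indicator (?A \<tau>) X)"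
      using AE_sample_01 AE_sample_distinct AE_space
    proof eventually_elim
      fix X assume X: "\<forall>i<n. \<forall>j<d. 0 < X i j \<and> X i j < 1"
        "\<forall>j<d. \<forall>i<n. \<forall>i'<n. i \<noteq> i' \<longrightarrow> X i j \<noteq> X i' j" "X \<in> space (sample_space d n)"
      have "interior_generators d n X = corner d X ` {\<tau> \<in> ?T. spans_corner d n X \<tau>}"
        unfolding interior_generators_eq_corners using X(1)
        by (intro arg_cong[where f = "\<lambda>A. corner d X ` A"]) (auto simp: PiE_iff)
      moreover have "inj_on (corner d X) ?T"
      proof (rule inj_onI)
        fix \<sigma> \<tau> assume *: "\<sigma> \<in> ?T" "\<tau> \<in> ?T" "corner d X \<sigma> = corner d X \<tau>"
        show "\<sigma> = \<tau>"
        proof (rule PiE_ext[OF *(1,2)])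
          fix j assume j: "j \<in> {..<d}"
          then have "X (\<sigma> j) j = X (\<tau> j) j" using fun_cong[OF *(3), of j] by (simp add: corner_def)
          moreover have "\<sigma> j < n" "\<tau> j < n" using *(1,2) j by (auto simp: PiE_iff)
          ultimately show "\<sigma> j = \<tau> j" using X(2) j unfolding lessThan_iff by metis
        qed
      qed
      ultimately have "card (interior_generators d n X) = card {\<tau> \<in> ?T. spans_corner d n X \<tau>}"
        using card_image[of "corner d X" "{\<tau> \<in> ?T. spans_corner d n X \<tau>}"] by (auto simp: inj_on_def)
      moreover have "(\<Sum>\<tau>\<in>?T. indicator (?A \<tau>) X) = (\<Sum>\<tau>\<in>?T. if spans_corner d n X \<tau> then 1 else (0::real))"
        using X(3) by (intro sum.cong refl) (simp add: indicator_def)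
      moreover have "\<dots> = real (card {\<tau> \<in> ?T. spans_corner d n X \<tau>})"
        unfolding sum.inter_filter[OF finT, symmetric] by simp
      ultimately show "real (card (interior_generators d n X)) = (\<Sum>\<tau>\<in>?T. indicator (?A \<tau>) X)"
        by presburger
    qed
  qed
  also have "\<dots> = (\<Sum>\<tau>\<in>?T. \<integral>X. indicator (?A \<tau>) X \<partial>sample_space d n)"
    using A by (intro Bochner_Integration.integral_sum integrable_real_indicator)
      (simp_all only: infinity_ennreal_def less_top[symmetric] emeasure_finite not_False_eq_True)
  also have "\<dots> = (\<Sum>\<tau>\<in>?T. prob (?A \<tau>))"
  proof (rule sum.cong[OF refl])
    fix \<tau> assume "\<tau> \<in> ?T"
    from sets.Int_space_eq2[OF A[OF this]]
    show "(\<integral>X. indicator (?A \<tau>) X \<partial>sample_space d n) = prob (?A \<tau>)"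
      by (simp only: Bochner_Integration.integral_indicator)
  qed
  finally show ?thesis .
qed

lemma card_PiE_inj_on:
  assumes "d \<le> n"
  shows "real (card {\<tau> \<in> {..<d} \<rightarrow>\<^sub>E {..<n::nat}. inj_on \<tau> {..<d}}) = fact n / fact (n - d)"
proof -
  have "(\<Prod>i = 0..<d. n - i) * fact (n - d) = fact n"
    using assms
  proof (induction d)
    case (Suc d)
    then have "fact (n - d) = (n - d) * fact (n - Suc d)"
      by (metis Suc_diff_Suc Suc_le_eq fact_Suc of_nat_id)
    with Suc show ?case by (simp add: mult_ac)
  qed simp
  moreover have "card {\<tau> \<in> {..<d} \<rightarrow>\<^sub>E {..<n}. inj_on \<tau> {..<d}} = (\<Prod>i = 0..<d. n - i)"
    using card_inj_on_subset_funcset[of "{..<d}" "{..<n}" "{..<d}"] by simp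
  ultimately have "real (card {\<tau> \<in> {..<d} \<rightarrow>\<^sub>E {..<n}. inj_on \<tau> {..<d}}) * fact (n - d) = fact n"
    by (metis of_nat_fact of_nat_mult)
  then show ?thesis by (simp add: field_simps)
qed

text \<open>All injective tuples contribute the same probability and the others contribute nothing,
  so the number of injections factors out.\<close>

lemma expected_interior_generators_closed_form:
  assumes "d \<le> n"
  shows "expected_interior_generators d n =
    fact n / fact (n - d) * (\<Sum>k\<le>n - d. (-1) ^ k * real ((n - d) choose k) / real (d + k) ^ d)" (is "_ = _ * ?s")
proof -
  let ?T = "{..<d} \<rightarrow>\<^sub>E {..<n} :: (nat \<Rightarrow> nat) set"
  have finT: "finite ?T" by (intro finite_PiE) auto
  have "expected_interior_generators d n = (\<Sum>\<tau>\<in>?T. if inj_on \<tau> {..<d} then ?s else 0)"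
    unfolding expected_interior_generators_eq_sum_prob
    by (intro sum.cong refl) (simp add: prob_spans_corner not_spans_corner)
  also have "\<dots> = real (card {\<tau> \<in> ?T. inj_on \<tau> {..<d}}) * ?s"
    unfolding sum.inter_filter[OF finT, symmetric] by simp
  finally show ?thesis using card_PiE_inj_on[OF assms] by simp
qed

section \<open>Derivatives and uniform asymptotics of Gamma quotients\<close>

text \<open>Induction on m. By Pascal's rule the sum for \<open>Suc m\<close> at s is the difference
  of the sums for m at s and at \<open>s + 1\<close>: both sides are iterated differences of
  \<open>1 / s\<close>.\<close>

lemma sum_binomial_partial_fractions:
  fixes s :: "'a :: field_char_0"
  assumes "\<And>k. k \<le> m \<Longrightarrow> s + of_nat k \<noteq> 0"
  shows "(\<Sum>k\<le>m. (-1) ^ k * of_nat (m choose k) / (s + of_nat k)) = fact m / pochhammer s (Suc m)"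
  using assms
proof (induction m arbitrary: s)
  case 0
  then show ?case by simp
next
  case (Suc m)
  let ?S = "\<lambda>s. \<Sum>k\<le>m. (-1) ^ k * of_nat (m choose k) / (s + of_nat k) :: 'a"
  define A where "A = pochhammer s (Suc m)"
  define B where "B = pochhammer (s + 1) (Suc m)"
  \<comment> \<open>Splitting off the first or the last factor provides the common denominator of
    the two sums given by the induction hypothesis.\<close>
  have P: "pochhammer s (Suc (Suc m)) = s * B" "pochhammer s (Suc (Suc m)) = A * (s + of_nat (Suc m))"
    unfolding A_def B_def by (rule pochhammer_rec, rule pochhammer_Suc)
  have nz: "pochhammer s (Suc (Suc m)) \<noteq> 0"
    using Suc.prems by (auto simp: pochhammer_eq_0_iff add_eq_0_iff2 less_Suc_eq_le)
  have S1: "?S s = fact m / A" unfolding A_def using Suc.prems by (intro Suc.IH) auto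
  have S2: "?S (s + 1) = fact m / B" unfolding B_def
  proof (intro Suc.IH)
    fix k assume "k \<le> m"
    then show "s + 1 + of_nat k \<noteq> 0" using Suc.prems[of "Suc k"] by (simp add: add_ac)
  qed
  have "(\<Sum>k\<le>Suc m. (-1) ^ k * of_nat (Suc m choose k) / (s + of_nat k)) =
      1 / s + (\<Sum>k\<le>m. (-1) ^ Suc k * of_nat (Suc m choose Suc k) / (s + of_nat (Suc k)))"
    by (subst sum.atMost_Suc_shift) simp
  also have "\<dots> = (1 / s + (\<Sum>k\<le>m. (-1) ^ Suc k * of_nat (m choose Suc k) / (s + of_nat (Suc k)))) - ?S (s + 1)"
    by (simp add: sum.distrib sum_subtractf ring_distribs add_divide_distrib diff_divide_distrib sum_negf add_ac)
  also have "1 / s + (\<Sum>k\<le>m. (-1) ^ Suc k * of_nat (m choose Suc k) / (s + of_nat (Suc k))) =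
      (\<Sum>k\<le>Suc m. (-1) ^ k * of_nat (m choose k) / (s + of_nat k))"
    by (subst sum.atMost_Suc_shift) simp
  also have "\<dots> = ?S s" by (simp add: binomial_eq_0)
  also have "?S s - ?S (s + 1) = fact (Suc m) / pochhammer s (Suc (Suc m))"
  proof -
    have "fact m / A = fact m * (s + of_nat (Suc m)) / pochhammer s (Suc (Suc m))"
      using nz by (simp add: P(2))
    moreover have "fact m / B = fact m * s / pochhammer s (Suc (Suc m))"
      using nz by (simp add: P(1))
    ultimately show ?thesis unfolding S1 S2
      by (simp add: algebra_simps flip: diff_divide_distrib)
  qed
  finally show ?case .
qed

text \<open>Taken at \<open>j = d - 1\<close> and \<open>s = d\<close>, this produces the powers
  \<open>(d + k) ^ d\<close> of the closed form. The half-plane is open and free of poles, so the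
  formula for j can itself be differentiated.\<close>

lemma higher_deriv_sum_simple_poles:
  assumes "Re s > 0"
  shows "(deriv ^^ j) (\<lambda>s. \<Sum>k\<le>m. c k / (s + of_nat k)) s =
         (-1) ^ j * fact j * (\<Sum>k\<le>m. c k / (s + of_nat k) ^ Suc j)"
  using assms
proof (induction j arbitrary: s)
  case (Suc j)
  have "eventually (\<lambda>w. w \<in> {w. Re w > 0}) (nhds s)"
    using Suc.prems by (intro eventually_nhds_in_open open_halfspace_Re_gt) auto
  then have "deriv ((deriv ^^ j) (\<lambda>s. \<Sum>k\<le>m. c k / (s + of_nat k))) s =
      deriv (\<lambda>s. (-1) ^ j * fact j * (\<Sum>k\<le>m. c k / (s + of_nat k) ^ Suc j)) s"
    using Suc.IH by (intro deriv_cong_ev refl) (auto elim!: eventually_mono)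
  also have "\<dots> = (-1) ^ j * fact j * (\<Sum>k\<le>m. - of_nat (Suc j) * c k / (s + of_nat k) ^ Suc (Suc j))"
  proof (intro DERIV_imp_deriv DERIV_cmult DERIV_sum)
    fix k
    define u where "u = s + of_nat k"
    have u: "u \<noteq> 0" using Suc.prems by (auto simp: u_def complex_eq_iff)
    have "((\<lambda>s. s + of_nat k) has_field_derivative 1) (at s)" by (auto intro!: derivative_eq_intros)
    note * = DERIV_quotient[OF DERIV_const[of "c k"] DERIV_power_Suc[OF this, of j], folded u_def]
    show "((\<lambda>s. c k / (s + of_nat k) ^ Suc j) has_field_derivative
        - of_nat (Suc j) * c k / (s + of_nat k) ^ Suc (Suc j)) (at s)"
      unfolding u_def[symmetric] by (rule DERIV_cong[OF *], use u in \<open>auto simp: divide_simps\<close>) (simp add: algebra_simps)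
  qed
  also have "\<dots> = (-1) ^ Suc j * fact (Suc j) * (\<Sum>k\<le>m. c k / (s + of_nat k) ^ Suc (Suc j))"
    unfolding sum_distrib_left
    by (intro sum.cong refl) (simp add: mult_ac del: of_nat_Suc)
  finally show ?case by simp
qed simp

text \<open>The complex derivative can be computed along the real axis, where the function is
  real-valued; by uniqueness of vector derivatives it equals its own real part.\<close>

lemma deriv_of_real_cong:
  fixes f :: "complex \<Rightarrow> complex" and g :: "real \<Rightarrow> real"
  assumes ev: "eventually (\<lambda>y. f (of_real y) = of_real (g y)) (nhds x)"
    and f: "f field_differentiable at (of_real x)"
  shows "deriv f (of_real x) = of_real (deriv g x)"
proof -
  let ?D = "deriv f (of_real x)"
  have "(f has_field_derivative ?D) (at (of_real x))"
    using f by (simp add: DERIV_deriv_iff_field_differentiable)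
  then have "((\<lambda>y. f (of_real y)) has_vector_derivative ?D) (at x)"
    by (rule has_vector_derivative_real_field)
  moreover have "((\<lambda>y. f (of_real y)) has_vector_derivative ?D) (at x) =
      ((\<lambda>y. of_real (g y)) has_vector_derivative ?D) (at x)"
    using ev by (intro has_vector_derivative_cong_ev) (auto elim: eventually_mono dest: eventually_nhds_x_imp_x)
  ultimately have D: "((\<lambda>y. of_real (g y)) has_vector_derivative ?D) (at x)" by simp
  have "((\<lambda>y. Re (of_real (g y))) has_vector_derivative Re ?D) (at x)"
    using D by (rule bounded_linear.has_vector_derivative[OF bounded_linear_Re])
  then have g: "(g has_field_derivative Re ?D) (at x)"
    by (simp add: has_real_derivative_iff_has_vector_derivative)
  then have "((\<lambda>y. of_real (g y)) has_vector_derivative complex_of_real (Re ?D)) (at x)"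
    by (rule has_vector_derivative_of_real)
  with D have "?D = of_real (Re ?D)" by (rule vector_derivative_unique_at)
  with g show ?thesis by (simp add: DERIV_imp_deriv)
qed

text \<open>Connects the derivatives of the real Gamma function in the final expansion with those of
  the complex one, to which Cauchy's inequality applies.\<close>

lemma higher_deriv_Gamma_complex_of_real:
  assumes "(x :: real) > 0"
  shows "(deriv ^^ j) Gamma (complex_of_real x) = of_real ((deriv ^^ j) Gamma x)"
  using assms
proof (induction j arbitrary: x)
  case 0
  then show ?case by (simp add: Gamma_complex_of_real)
next
  case (Suc j)
  have "(deriv ^^ j) Gamma holomorphic_on (- \<int>\<^sub>\<le>\<^sub>0 :: complex set)"
    by (intro holomorphic_intros) auto
  moreover have "complex_of_real x \<in> - \<int>\<^sub>\<le>\<^sub>0" using Suc.prems by (auto elim!: nonpos_Ints_cases' simp: complex_eq_iff)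
  ultimately have "(deriv ^^ j) Gamma field_differentiable at (complex_of_real x)"
    by (intro holomorphic_on_imp_differentiable_at[of _ "- \<int>\<^sub>\<le>\<^sub>0"]) auto
  moreover have "eventually (\<lambda>y. y \<in> {0<..}) (nhds x)"
    using Suc.prems by (intro eventually_nhds_in_open) auto
  then have "eventually (\<lambda>y. (deriv ^^ j) Gamma (complex_of_real y) = of_real ((deriv ^^ j) Gamma y)) (nhds x)"
    by eventually_elim (use Suc.IH in auto)
  ultimately show ?case by (simp add: deriv_of_real_cong)
qed

lemma higher_deriv_exp_linear:
  "(deriv ^^ k) (\<lambda>s. exp (- ((s - a) * L))) (s :: complex) = (- L) ^ k * exp (- ((s - a) * L))"
proof (induction k arbitrary: s)
  case (Suc k)
  have "(deriv ^^ k) (\<lambda>s. exp (- ((s - a) * L))) = (\<lambda>s. (- L) ^ k * exp (- ((s - a) * L)))"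
    using Suc.IH by (rule ext)
  then have "(deriv ^^ Suc k) (\<lambda>s. exp (- ((s - a) * L))) s = deriv (\<lambda>s. (- L) ^ k * exp (- ((s - a) * L))) s"
    by simp
  also have "\<dots> = (- L) ^ Suc k * exp (- ((s - a) * L))"
    by (rule DERIV_imp_deriv) (auto intro!: derivative_eq_intros)
  finally show ?case .
qed simp

text \<open>Relative increments of order \<open>1 / n ^ 2\<close> are summable. A discrete Gronwall
  argument first bounds all \<open>g n\<close>; summing increments from n onwards then gives a tail
  of order \<open>1 / n\<close>. The constant depends only on \<open>B\<close> and \<open>C\<close>,
  which makes the bound uniform over families of sequences.\<close>

lemma telescoping_ratio_bound:
  fixes g :: "nat \<Rightarrow> complex"
  assumes step: "\<And>n. n \<ge> 1 \<Longrightarrow> norm (g (Suc n) - g n) \<le> C / real n ^ 2 * norm (g n)"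
    and g1: "norm (g 1) \<le> B" and lim: "g \<longlonglongrightarrow> l" and C: "C \<ge> 0" and n: "n \<ge> 1"
  shows "norm (g n - l) \<le> 2 * C * B * exp (2 * C) / real n"
proof -
  \<comment> \<open>The factor 2 comes from \<open>Suc n \<le> 2 * n\<close>.\<close>
  have tele: "1 / real n ^ 2 \<le> 2 * (1 / real n - 1 / real (Suc n))" if "n \<ge> 1" for n
  proof -
    have "1 / real n - 1 / real (Suc n) = 1 / (real n * real (Suc n))" using that by (simp add: field_simps)
    moreover have "2 / (2 * real n ^ 2) \<le> 2 / (real n * real (Suc n))"
      using that by (intro divide_left_mono) (use that in \<open>auto simp: power2_eq_square algebra_simps intro!: add_pos_pos mult_pos_pos\<close>)
    ultimately show ?thesis by simp
  qed
  have B: "B \<ge> 0" using g1 norm_ge_zero order_trans by blast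
  define B' where "B' = B * exp (2 * C)"
  have B': "B' \<ge> 0" using B by (simp add: B'_def)
  \<comment> \<open>The exponent dominates $\sum_{k<n} C / k^2$ by telescoping.\<close>
  have "norm (g n) \<le> B * exp (2 * C * (1 - 1 / real n))" if "n \<ge> 1" for n
    using that
  proof (induction n rule: dec_induct)
    case base
    then show ?case using g1 by simp
  next
    case (step n)
    have "norm (g (Suc n)) \<le> norm (g n) + norm (g (Suc n) - g n)"
      by (metis add_diff_cancel_left' add.commute diff_add_cancel norm_triangle_ineq)
    also have "\<dots> \<le> (1 + C / real n ^ 2) * norm (g n)" using assms(1)[of n] step by (simp add: algebra_simps)
    also have "\<dots> \<le> exp (C / real n ^ 2) * (B * exp (2 * C * (1 - 1 / real n)))"
      using step C by (intro mult_mono exp_ge_add_one_self) auto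
    also have "\<dots> \<le> exp (2 * C * (1 / real n - 1 / real (Suc n))) * (B * exp (2 * C * (1 - 1 / real n)))"
    proof (intro mult_right_mono)
      show "exp (C / real n ^ 2) \<le> exp (2 * C * (1 / real n - 1 / real (Suc n)))"
        using mult_left_mono[OF tele[of n] C] step by (simp add: algebra_simps)
    qed (use B in auto)
    also have "\<dots> = B * exp (2 * C * (1 - 1 / real (Suc n)))"
      by (simp add: algebra_simps flip: exp_add)
    finally show ?case .
  qed
  moreover have "B * exp (2 * C * (1 - 1 / real n)) \<le> B'" if "n \<ge> 1" for n
    unfolding B'_def using B C mult_left_mono[of "1 - 1 / real n" 1 "2 * C"] that by (intro mult_left_mono) auto
  ultimately have bdd: "norm (g n) \<le> B'" if "n \<ge> 1" for n using that order_trans by blast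
  have "norm (g N - g n) \<le> 2 * C * B' * (1 / real n - 1 / real N)" if "N \<ge> n" for N
    using that
  proof (induction N rule: dec_induct)
    case (step N)
    have "norm (g (Suc N) - g n) \<le> norm (g (Suc N) - g N) + norm (g N - g n)"
      using norm_triangle_ineq[of "g (Suc N) - g N" "g N - g n"] by simp
    also have "norm (g (Suc N) - g N) \<le> C / real N ^ 2 * B'"
      using assms(1)[of N] mult_left_mono[OF bdd[of N], of "C / real N ^ 2"] C step n by simp
    also have "\<dots> = C * B' * (1 / real N ^ 2)" by simp
    also have "\<dots> \<le> C * B' * (2 * (1 / real N - 1 / real (Suc N)))"
      using C B' step n by (intro mult_left_mono tele) auto
    also note step.IH
    finally show ?case by (simp add: algebra_simps)
  qed simp
  moreover have "2 * C * B' * (1 / real n - 1 / real N) \<le> 2 * C * B' * (1 / real n)" for N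
    using C B' by (intro mult_left_mono) auto
  \<comment> \<open>The bound no longer depends on \<open>N\<close>, so it survives the limit of
    \<open>g N\<close>.\<close>
  ultimately have "eventually (\<lambda>N. norm (g N - g n) \<le> 2 * C * B' * (1 / real n)) sequentially"
    using order_trans by (intro eventually_sequentiallyI[of n]) blast
  moreover have "(\<lambda>N. norm (g N - g n)) \<longlonglongrightarrow> norm (l - g n)" by (intro tendsto_intros lim)
  ultimately have "norm (l - g n) \<le> 2 * C * B' * (1 / real n)"
    by (intro tendsto_upperbound) auto
  then show ?thesis by (simp add: B'_def norm_minus_commute mult_ac)
qed

text \<open>With \<open>w = z * t\<close> and \<open>u = 1 + z / Suc n\<close>, the expression is
  \<open>exp w / u - 1\<close>. Numerator and denominator agree up to order \<open>1 / n\<close>,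
  because t lies between \<open>1 / Suc n\<close> and \<open>1 / n\<close>; the quadratic remainder
  of \<open>exp\<close> and the difference of w and \<open>z / Suc n\<close> are both of order
  \<open>1 / n ^ 2\<close>.\<close>

lemma rGamma_ratio_step_bound:
  fixes z :: complex
  assumes z: "norm z \<le> 1/2" and n: "n \<ge> 1"
  shows "norm (of_nat (Suc n) / (of_nat (Suc n) + z) * exp (z * of_real (ln (real (Suc n)) - ln (real n))) - 1)
           \<le> 2 / real n ^ 2"
proof -
  define t where "t = ln (real (Suc n)) - ln (real n)"
  have "1 + 1 / real n = real (Suc n) / real n" using n by (simp add: field_simps)
  then have t_eq: "t = ln (1 + 1 / real n)" using n by (simp add: t_def ln_div)
  have t1: "t \<le> 1 / real n" unfolding t_eq by (rule ln_add_one_self_le_self) simp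
  have t2: "1 / real (Suc n) \<le> t"
  proof -
    have "ln (real n / real (Suc n)) \<le> real n / real (Suc n) - 1" using n by (intro ln_le_minus_one) auto
    then show ?thesis using n by (simp add: t_def ln_div field_simps)
  qed
  have t0: "t \<ge> 0" using t2 by (rule order_trans[rotated]) simp
  define w where "w = z * of_real t"
  have w: "norm w \<le> 1 / (2 * real n)"
    using mult_mono[OF z t1] t0 by (simp add: w_def norm_mult)
  have w2: "norm w \<le> 1/2" 
  proof -
    have "1 / (2 * real n) \<le> 1/2" using n by (simp add: field_simps)
    with w show ?thesis by linarith
  qed
  have "norm (exp w - (1 + w)) \<le> exp \<bar>Re w\<bar> * norm w ^ 2"
    using Taylor_exp[of w 1] by (simp add: power2_eq_square)
  also have "\<dots> \<le> 2 * norm w ^ 2"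
  proof (intro mult_right_mono)
    have "\<bar>Re w\<bar> \<le> 1/2" using abs_Re_le_cmod w2 order_trans by blast
    then have "norm (exp \<bar>Re w\<bar>) \<le> 2" by (intro exp_bound_half) auto
    then show "exp \<bar>Re w\<bar> \<le> 2" by simp
  qed simp
  also have "\<dots> \<le> 2 * (1 / (2 * real n)) ^ 2" using w by (intro mult_left_mono power_mono) auto
  finally have e1: "norm (exp w - (1 + w)) \<le> 1 / (2 * real n ^ 2)" by (simp add: power2_eq_square)
  have e2: "norm (w - z / of_nat (Suc n)) \<le> 1 / (2 * real n ^ 2)"
  proof -
    have "w - z / of_nat (Suc n) = z * of_real (t - 1 / real (Suc n))"
      by (simp add: w_def algebra_simps)
    then have "norm (w - z / of_nat (Suc n)) = norm z * (t - 1 / real (Suc n))"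
      using t2 by (simp add: norm_mult del: of_real_diff)
    also have "\<dots> \<le> 1/2 * (1 / real n - 1 / real (Suc n))" using z t1 t2 by (intro mult_mono) auto
    also have "1 / real n - 1 / real (Suc n) = 1 / (real n * real (Suc n))" using n by (simp add: field_simps)
    also have "\<dots> \<le> 1 / real n ^ 2"
      using n by (intro divide_left_mono) (auto simp: power2_eq_square intro!: mult_pos_pos)
    finally have "norm (w - z / of_nat (Suc n)) \<le> 1/2 * (1 / real n ^ 2)" by simp
    also have "\<dots> = 1 / (2 * real n ^ 2)" by simp
    finally show ?thesis .
  qed
  define u where "u = 1 + z / of_nat (Suc n)"
  have "norm (z / of_nat (Suc n)) \<le> 1/2"
    using z by (simp add: norm_divide field_simps del: of_nat_Suc)
  \<comment> \<open>Division by \<open>u\<close> costs at most a factor 2, which is the constant in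
    the statement.\<close>
  then have u: "norm u \<ge> 1/2" using norm_diff_ineq[of 1 "z / of_nat (Suc n)"] by (simp add: u_def)
  then have u0: "u \<noteq> 0" by auto
  have "norm (exp w - u) \<le> norm (exp w - (1 + w)) + norm (w - z / of_nat (Suc n))"
  proof -
    have "exp w - u = (exp w - (1 + w)) + (w - z / of_nat (Suc n))" by (simp add: u_def)
    then show ?thesis by (simp only: norm_triangle_ineq)
  qed
  also have "\<dots> \<le> 1 / real n ^ 2" using e1 e2 by (simp add: field_simps)
  finally have e: "norm (exp w - u) \<le> 1 / real n ^ 2" .
  have "of_nat (Suc n) + z = of_nat (Suc n) * u" by (simp add: u_def ring_distribs del: of_nat_Suc)
  then have "of_nat (Suc n) / (of_nat (Suc n) + z) * exp w - 1 = (exp w - u) / u"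
    using u0 by (simp add: diff_divide_distrib del: of_nat_Suc)
  then have "norm (of_nat (Suc n) / (of_nat (Suc n) + z) * exp w - 1) = norm (exp w - u) / norm u"
    by (simp add: norm_divide)
  also have "\<dots> \<le> (1 / real n ^ 2) / (1/2)" using e u by (intro frac_le) auto
  finally show ?thesis by (simp add: w_def t_def)
qed

text \<open>For fixed z the quotient tends to 1 by Gauss's limit formula, and its relative
  increments were just bounded. The telescoping bound then supplies the rate, uniformly in
  z.\<close>

lemma Gamma_ratio_uniform_asymp:
  obtains C where "\<And>n z. n \<ge> 1 \<Longrightarrow> norm z \<le> 1/2 \<Longrightarrow>
    norm (fact n * exp (z * of_real (ln (real n))) * rGamma (1 + z + of_nat n) - (1 :: complex)) \<le> C / real n"
proof -
  define g where "g z n = fact n * exp (z * of_real (ln (real n))) * rGamma (1 + z + of_nat n)" for z :: complex and n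
  \<comment> \<open>The initial value \<open>g z 1\<close> equals \<open>rGamma (2 + z)\<close>, so
    compactness of this ball bounds it uniformly in z.\<close>
  have "compact (rGamma ` cball (2 :: complex) (1/2))"
    by (intro compact_continuous_image continuous_intros) auto
  then have "bounded (rGamma ` cball (2 :: complex) (1/2))" by (rule compact_imp_bounded)
  then obtain B where B: "\<And>w. w \<in> cball (2 :: complex) (1/2) \<Longrightarrow> norm (rGamma w) \<le> B"
    unfolding bounded_iff by blast
  have "norm (g z n - 1) \<le> 2 * 2 * B * exp (2 * 2) / real n" if n: "n \<ge> 1" and z: "norm z \<le> 1/2" for n z
  proof (rule telescoping_ratio_bound[OF _ _ _ _ n])
    have "2 + z \<in> cball 2 (1/2)" using z by (simp add: dist_norm)
    from B[OF this] show "norm (g z 1) \<le> B" by (simp add: g_def add_ac)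
    fix n :: nat assume n: "n \<ge> 1"
    define v where "v = of_nat (Suc n) + z"
    have v0: "v \<noteq> 0"
    proof
      assume "v = 0"
      then have "z = - of_nat (Suc n)" by (simp add: v_def add_eq_0_iff)
      then have "norm z = real (Suc n)" by (simp only: norm_minus_cancel norm_of_nat)
      then show False using z by simp
    qed
    have r: "rGamma (1 + z + of_nat n) = v * rGamma (1 + z + of_nat (Suc n))"
      using rGamma_plus1[of v] by (simp add: v_def add_ac)
    have ex: "exp (z * of_real (ln (real (Suc n)))) =
        exp (z * of_real (ln (real (Suc n)) - ln (real n))) * exp (z * of_real (ln (real n)))"
      by (simp add: algebra_simps flip: exp_add)
    have "g z (Suc n) = of_nat (Suc n) / v * exp (z * of_real (ln (real (Suc n)) - ln (real n))) * g z n"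
      unfolding g_def r ex fact_Suc using v0 by (simp del: of_nat_Suc)
    then have "g z (Suc n) - g z n =
        (of_nat (Suc n) / v * exp (z * of_real (ln (real (Suc n)) - ln (real n))) - 1) * g z n"
      by (simp add: algebra_simps)
    then show "norm (g z (Suc n) - g z n) \<le> 2 / real n ^ 2 * norm (g z n)"
      unfolding norm_mult v_def
      using rGamma_ratio_step_bound[OF z n] by (simp only: norm_mult mult_right_mono norm_ge_zero)
  next
    have ninv: "1 + z \<notin> \<int>\<^sub>\<le>\<^sub>0"
    proof
      assume "1 + z \<in> \<int>\<^sub>\<le>\<^sub>0"
      then obtain n where "1 + z = - of_nat n" by (auto elim!: nonpos_Ints_cases')
      then have "Re (1 + z) = - real n" by (simp only: uminus_complex.sel complex_Re_of_nat)
      then show False using z abs_Re_le_cmod[of z] by auto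
    qed
    \<comment> \<open>Gauss's product times \<open>rGamma (1 + z)\<close> is
      \<open>n! * n powr (1 + z) * rGamma (2 + z + n)\<close> up to notation; the last factor,
      \<open>(1 + z + n) / n\<close>, converts this into \<open>g z n\<close> for positive n and
      tends to 1.\<close>
    have "(\<lambda>n. Gamma_series (1 + z) n * rGamma (1 + z) * ((1 + z) / of_nat n + 1)) \<longlonglongrightarrow>
        Gamma (1 + z) * rGamma (1 + z) * (0 + 1)"
      by (intro tendsto_intros lim_const_over_n)
    also have "Gamma (1 + z) * rGamma (1 + z) * (0 + 1) = 1"
      using ninv by (simp add: Gamma_def rGamma_eq_zero_iff)
    finally show "g z \<longlonglongrightarrow> 1"
    proof (rule Lim_transform_eventually)
      show "\<forall>\<^sub>F n in sequentially. Gamma_series (1 + z) n * rGamma (1 + z) * ((1 + z) / of_nat n + 1) = g z n"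
        using eventually_gt_at_top[of 0]
      proof eventually_elim
        case (elim n)
        have rz: "rGamma (1 + z) \<noteq> 0" using ninv by (simp add: rGamma_eq_zero_iff)
        have r: "rGamma (1 + z + of_nat n) = (1 + z + of_nat n) * rGamma (1 + z + of_nat (Suc n))"
          using rGamma_plus1[of "1 + z + of_nat n"] by (simp add: add_ac)
        have "pochhammer (1 + z) (n + 1) * rGamma (1 + z + of_nat (Suc n)) = rGamma (1 + z)"
          using pochhammer_rGamma[of "1 + z" "Suc n"] rz by simp
        moreover from this have "pochhammer (1 + z) (n + 1) \<noteq> 0" using rz by auto
        ultimately have "inverse (pochhammer (1 + z) (n + 1)) * rGamma (1 + z) = rGamma (1 + z + of_nat (Suc n))"
          using rz by (simp add: field_simps) 
        moreover have "exp ((1 + z) * of_real (ln (real n))) = of_nat n * exp (z * of_real (ln (real n)))"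
          using elim by (simp add: ring_distribs exp_add exp_of_real)
        ultimately have "Gamma_series (1 + z) n * rGamma (1 + z) =
            fact n * (of_nat n * exp (z * of_real (ln (real n)))) * rGamma (1 + z + of_nat (Suc n))"
          by (simp add: Gamma_series_def divide_inverse mult_ac)
        then show ?case unfolding g_def r using elim by (simp add: field_simps)
      qed
    qed
  qed auto
  then show ?thesis by (intro that) (simp add: g_def)
qed

section \<open>Asymptotic expansion\<close>

text \<open>Partial fractions write the factorial quotient as a sum of simple poles at the points
  -k; differentiating \<open>d - 1\<close> times at d raises the denominators to the power d and
  recovers the closed form.\<close>

lemma expected_interior_generators_eq_higher_deriv:
  assumes d: "1 \<le> d" "d \<le> n"
  shows "complex_of_real (expected_interior_generators d n) = (-1) ^ (d - 1) / fact (d - 1) *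
    (deriv ^^ (d - 1)) (\<lambda>s. fact n / pochhammer s (Suc (n - d))) (of_nat d)"
proof -
  define m where "m = n - d"
  define c :: "nat \<Rightarrow> complex" where "c k = fact n / fact m * ((-1) ^ k * of_nat (m choose k))" for k
  have F: "fact n / pochhammer s (Suc m) = (\<Sum>k\<le>m. c k / (s + of_nat k))" if "Re s > 0" for s
  proof -
    have "s + of_nat k \<noteq> 0" for k using that by (auto simp: complex_eq_iff)
    then have "(\<Sum>k\<le>m. (-1) ^ k * of_nat (m choose k) / (s + of_nat k)) = fact m / pochhammer s (Suc m)"
      by (intro sum_binomial_partial_fractions) auto
    then have "fact n / pochhammer s (Suc m) =
        fact n / fact m * (\<Sum>k\<le>m. (-1) ^ k * of_nat (m choose k) / (s + of_nat k))" by simp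
    then show ?thesis by (simp add: c_def sum_distrib_left)
  qed
  have "eventually (\<lambda>s. s \<in> {s. Re s > 0}) (nhds (of_nat d))"
    using d by (intro eventually_nhds_in_open open_halfspace_Re_gt) auto
  then have "(deriv ^^ (d - 1)) (\<lambda>s. fact n / pochhammer s (Suc m)) (of_nat d) =
      (deriv ^^ (d - 1)) (\<lambda>s. \<Sum>k\<le>m. c k / (s + of_nat k)) (of_nat d)"
    by (intro higher_deriv_cong_ev refl) (auto elim!: eventually_mono simp: F)
  also have "\<dots> = (-1) ^ (d - 1) * fact (d - 1) * (\<Sum>k\<le>m. c k / (of_nat d + of_nat k) ^ d)"
    using d by (subst higher_deriv_sum_simple_poles) auto
  also have "(\<Sum>k\<le>m. c k / (of_nat d + of_nat k) ^ d) = complex_of_real (expected_interior_generators d n)"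
    unfolding expected_interior_generators_closed_form[OF d(2)] by (simp add: c_def m_def sum_distrib_left)
  finally show ?thesis by (simp add: m_def power_mult_distrib[symmetric])
qed

lemma holomorphic_on_inverse_pochhammer:
  "(\<lambda>s. a / pochhammer s m) holomorphic_on {s. Re s > 0}"
proof -
  have "pochhammer s m \<noteq> 0" if "Re s > 0" for s :: complex
    using that unfolding pochhammer_eq_0_iff by (auto simp: complex_eq_iff)
  moreover have "(\<lambda>s :: complex. pochhammer s m) holomorphic_on {s. Re s > 0}"
    unfolding pochhammer_prod by (intro holomorphic_intros)
  ultimately show ?thesis by (intro holomorphic_intros) auto
qed

lemma holomorphic_on_Gamma_halfplane: "Gamma holomorphic_on {s :: complex. Re s > 0}"
  by (intro holomorphic_Gamma) (auto elim!: nonpos_Ints_cases')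

text \<open>With \<open>z = s - d\<close> the quotient is \<open>Gamma s * exp (- z * ln n)\<close>
  times the factor controlled by \<open>Gamma_ratio_uniform_asymp\<close>, as the last Gamma
  argument is \<open>1 + z + n\<close>. The norm of the exponential stays in the bound, so that the
  radius around d can later shrink with n.\<close>

lemma factorial_quotient_asymp:
  assumes "1 \<le> d"
  obtains C where "\<And>n s. 1 \<le> n \<Longrightarrow> d \<le> n \<Longrightarrow> norm (s - of_nat d) \<le> 1/2 \<Longrightarrow>
     norm (fact n / pochhammer s (Suc (n - d)) - Gamma s * exp (- ((s - of_nat d) * of_real (ln (real n)))) :: complex)
     \<le> norm (exp (- ((s - of_nat d) * of_real (ln (real n))))) * C / real n"
proof -
  obtain C where C: "\<And>n z. n \<ge> 1 \<Longrightarrow> norm z \<le> 1/2 \<Longrightarrow>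
    norm (fact n * exp (z * of_real (ln (real n))) * rGamma (1 + z + of_nat n) - (1 :: complex)) \<le> C / real n"
    using Gamma_ratio_uniform_asymp by blast
  have Re_pos: "Re s > 0" if "norm (s - of_nat d) \<le> 1/2" for s
    using abs_Re_le_cmod[of "s - of_nat d"] that assms by simp
  have "bounded (Gamma ` cball (of_nat d :: complex) (1/2))"
  proof (intro compact_imp_bounded compact_continuous_image)
    show "continuous_on (cball (of_nat d :: complex) (1/2)) Gamma"
      by (rule holomorphic_on_imp_continuous_on[OF holomorphic_on_subset[OF holomorphic_on_Gamma_halfplane]])
         (auto simp: dist_norm norm_minus_commute intro!: Re_pos)
  qed auto
  then obtain M where "\<And>s. s \<in> cball (of_nat d) (1/2) \<Longrightarrow> norm (Gamma s :: complex) \<le> M"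
    unfolding bounded_iff by blast
  then have M: "norm (Gamma s) \<le> M" if "norm (s - of_nat d) \<le> 1/2" for s :: complex
    using that by (simp add: dist_norm norm_minus_commute)
  have M0: "M \<ge> 0" using order_trans[OF norm_ge_zero M[of "of_nat d"]] by simp
  show ?thesis
  proof (rule that[of "M * C"])
    fix n :: nat and s :: complex assume n: "1 \<le> n" "d \<le> n" and s: "norm (s - of_nat d) \<le> 1/2"
    define z where "z = s - of_nat d"
    define E where "E = exp (z * of_real (ln (real n)))"
    define G where "G = fact n * E * rGamma (1 + z + of_nat n)"
    have G: "norm (G - 1) \<le> C / real n" unfolding G_def E_def using n s by (intro C) (simp_all add: z_def)
    have "s \<notin> \<int>\<^sub>\<le>\<^sub>0" using Re_pos[OF s] by (auto elim!: nonpos_Ints_cases')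
    then have "pochhammer s (Suc (n - d)) = Gamma (s + of_nat (Suc (n - d))) / Gamma s"
      by (rule pochhammer_Gamma)
    also have "s + of_nat (Suc (n - d)) = 1 + z + of_nat n" using n by (simp add: z_def of_nat_diff)
    finally have "fact n / pochhammer s (Suc (n - d)) = Gamma s * (fact n * rGamma (1 + z + of_nat n))"
      by (simp add: rGamma_inverse_Gamma divide_inverse)
    also have "\<dots> = Gamma s * exp (- (z * of_real (ln (real n)))) * G"
      by (simp add: G_def E_def exp_minus field_simps)
    finally have "fact n / pochhammer s (Suc (n - d)) - Gamma s * exp (- (z * of_real (ln (real n)))) =
        exp (- (z * of_real (ln (real n)))) * (Gamma s * (G - 1))" by (simp add: algebra_simps)
    also have "norm \<dots> \<le> norm (exp (- (z * of_real (ln (real n))))) * (M * (C / real n))"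
      unfolding norm_mult using M[OF s] G M0 by (intro mult_left_mono mult_mono) auto
    finally show "norm (fact n / pochhammer s (Suc (n - d)) - Gamma s * exp (- ((s - of_nat d) * of_real (ln (real n)))))
        \<le> norm (exp (- ((s - of_nat d) * of_real (ln (real n))))) * (M * C) / real n"
      by (simp add: z_def)
  qed
qed

text \<open>Leibniz rule: at \<open>s = d\<close> the exponential is 1, so its derivative of order
  \<open>p - j\<close> is \<open>(- L) ^ (p - j)\<close>. The binomial coefficient over
  \<open>fact p\<close> leaves \<open>1 / (fact j * fact (p - j))\<close>, and the signs combine to
  \<open>(-1) ^ j\<close>.\<close>

lemma higher_deriv_Gamma_mult_exp:
  assumes d: "1 \<le> d" and L: "L > 0"
  shows "(-1) ^ (d - 1) / fact (d - 1) *
      (deriv ^^ (d - 1)) (\<lambda>s. Gamma s * exp (- ((s - of_nat d) * of_real L))) (of_nat d) =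
    complex_of_real (L ^ (d - 1) * (\<Sum>j = 0..d - 1. (-1) ^ j * (deriv ^^ j) (Gamma :: real \<Rightarrow> real) (real d)
                 / (fact j * fact (d - 1 - j)) / L ^ j))"
proof -
  define p where "p = d - 1"
  have "(deriv ^^ p) (\<lambda>s :: complex. Gamma s * exp (- ((s - of_nat d) * of_real L))) (of_nat d) =
      (\<Sum>j = 0..p. of_nat (p choose j) * (deriv ^^ j) Gamma (of_nat d) *
         (deriv ^^ (p - j)) (\<lambda>s. exp (- ((s - of_nat d) * of_real L))) (of_nat d))"
    using d by (intro higher_deriv_mult[of _ "{s. Re s > 0}"] holomorphic_on_Gamma_halfplane open_halfspace_Re_gt)
       (auto intro!: holomorphic_intros)
  also have "\<dots> = (\<Sum>j = 0..p. complex_of_real (real (p choose j) * (deriv ^^ j) Gamma (real d) * (- L) ^ (p - j)))"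
    using higher_deriv_Gamma_complex_of_real[of "real d"] d by (simp add: higher_deriv_exp_linear)
  finally have "(-1) ^ p / fact p * (deriv ^^ p) (\<lambda>s. Gamma s * exp (- ((s - of_nat d) * of_real L))) (of_nat d) =
      complex_of_real (\<Sum>j = 0..p. (-1) ^ p / fact p * (real (p choose j) * (deriv ^^ j) Gamma (real d) * (- L) ^ (p - j)))"
    by (simp add: sum_distrib_left)
  also have "(\<Sum>j = 0..p. (-1) ^ p / fact p * (real (p choose j) * (deriv ^^ j) Gamma (real d) * (- L) ^ (p - j))) =
      (\<Sum>j = 0..p. L ^ p * ((-1) ^ j * (deriv ^^ j) Gamma (real d) / (fact j * fact (p - j)) / L ^ j))"
  proof (rule sum.cong[OF refl])
    fix j assume "j \<in> {0..p}"
    then have j: "j \<le> p" by simp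
    have "real (p choose j) / fact p = 1 / (fact j * fact (p - j))"
      using binomial_fact[OF j, where 'a = real] by simp
    moreover have "(-1) ^ p * (- L) ^ (p - j) = (-1) ^ j * (L ^ p / L ^ j)"
    proof -
      have "(-1 :: real) ^ p = (-1) ^ j * (-1) ^ (p - j)" using j by (simp flip: power_add)
      moreover have "(- L) ^ (p - j) = (-1) ^ (p - j) * L ^ (p - j)" by (rule power_minus)
      moreover have "(-1 :: real) ^ (p - j) * (-1) ^ (p - j) = 1" by (simp flip: power_mult_distrib)
      moreover have "L ^ (p - j) = L ^ p / L ^ j" using j L by (intro power_diff) auto
      ultimately show ?thesis by (metis (no_types, opaque_lifting) mult.assoc mult.left_neutral)
    qed
    ultimately have "((-1) ^ p * (- L) ^ (p - j)) * (real (p choose j) / fact p) * (deriv ^^ j) Gamma (real d) =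
        ((-1) ^ j * (L ^ p / L ^ j)) * (1 / (fact j * fact (p - j))) * (deriv ^^ j) Gamma (real d)" by simp
    then show "(-1) ^ p / fact p * (real (p choose j) * (deriv ^^ j) Gamma (real d) * (- L) ^ (p - j)) =
        L ^ p * ((-1) ^ j * (deriv ^^ j) Gamma (real d) / (fact j * fact (p - j)) / L ^ j)"
      by (simp add: mult_ac)
  qed
  finally show ?thesis by (simp add: p_def sum_distrib_left)
qed

theorem theoremT:
  fixes d :: nat
  assumes "d \<ge> 1"
  shows "(\<lambda>n. expected_interior_generators d n
            - ln (real n) ^ (d - 1) *
              (\<Sum>j = 0..d - 1. (-1) ^ j * (deriv ^^ j) (Gamma :: real \<Rightarrow> real) (real d)
                 / (fact j * fact (d - 1 - j)) / ln (real n) ^ j))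
         \<in> O(\<lambda>n. ln (real n) ^ (d - 1) / real n)"
proof -
  obtain C where C: "\<And>n s. 1 \<le> n \<Longrightarrow> d \<le> n \<Longrightarrow> norm (s - of_nat d) \<le> 1/2 \<Longrightarrow>
     norm (fact n / pochhammer s (Suc (n - d)) - Gamma s * exp (- ((s - of_nat d) * of_real (ln (real n)))) :: complex)
     \<le> norm (exp (- ((s - of_nat d) * of_real (ln (real n))))) * C / real n"
    using assms by (rule factorial_quotient_asymp) blast
  \<comment> \<open>The bound at \<open>n = d\<close>, \<open>s = d\<close> has a norm on the left
    and \<open>C / d\<close> on the right.\<close>
  have C0: "C \<ge> 0"
    using order_trans[OF norm_ge_zero C[of d "of_nat d"]] assms by (simp add: zero_le_divide_iff)
  \<comment> \<open>Ensures that the circle of radius \<open>1 / ln n\<close> lies in the disc of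
    radius 1/2 where the asymptotics are uniform.\<close>
  have "eventually (\<lambda>n. ln (real n) \<ge> 2) sequentially" by real_asymp
  then have "eventually (\<lambda>n. norm (expected_interior_generators d n
            - ln (real n) ^ (d - 1) *
              (\<Sum>j = 0..d - 1. (-1) ^ j * (deriv ^^ j) (Gamma :: real \<Rightarrow> real) (real d)
                 / (fact j * fact (d - 1 - j)) / ln (real n) ^ j))
      \<le> exp 1 * C * norm (ln (real n) ^ (d - 1) / real n)) sequentially"
    using eventually_ge_at_top[of d]
  proof eventually_elim
    case (elim n)
    define L where "L = ln (real n)"
    have L: "L \<ge> 2" and n: "d \<le> n" "1 \<le> n" using elim assms by (auto simp: L_def)
    define F where "F s = fact n / pochhammer s (Suc (n - d))" for s :: complex
    define H where "H s = Gamma s * exp (- ((s - of_nat d) * of_real L))" for s :: complex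
    let ?U = "{s. Re s > 0}"
    have hol: "F holomorphic_on ?U" "H holomorphic_on ?U"
      unfolding F_def H_def
      by (intro holomorphic_on_inverse_pochhammer holomorphic_intros holomorphic_on_Gamma_halfplane)+
    have r: "1 / L \<le> 1/2" "1 / L > 0" using L by (auto simp: field_simps)
    have U: "cball (of_nat d) (1 / L) \<subseteq> ?U"
    proof
      fix s assume "s \<in> cball (of_nat d :: complex) (1 / L)"
      then have "norm (s - of_nat d) \<le> 1 / L" by (simp add: dist_norm norm_minus_commute)
      then have "norm (s - of_nat d) \<le> 1/2" using r(1) by linarith
      then show "s \<in> ?U" using abs_Re_le_cmod[of "s - of_nat d"] assms by simp
    qed
    \<comment> \<open>On the circle of radius \<open>1 / L\<close> the exponent has norm 1, so the
      exponential is at most \<open>exp 1\<close>; the power of the radius in Cauchy's inequality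
      produces \<open>L ^ (d - 1)\<close>.\<close>
    have "norm ((deriv ^^ (d - 1)) (\<lambda>s. F s - H s) (of_nat d)) \<le>
        fact (d - 1) * (exp 1 * C / real n) / (1 / L) ^ (d - 1)"
    proof (rule Cauchy_inequality)
      have "(\<lambda>s. F s - H s) holomorphic_on cball (of_nat d) (1 / L)"
        using holomorphic_on_subset[OF hol(1) U] holomorphic_on_subset[OF hol(2) U] by (intro holomorphic_intros)
      then show "(\<lambda>s. F s - H s) holomorphic_on ball (of_nat d) (1 / L)"
        "continuous_on (cball (of_nat d) (1 / L)) (\<lambda>s. F s - H s)"
        by (auto intro: holomorphic_on_subset holomorphic_on_imp_continuous_on)
      show "0 < 1 / L" by fact
      fix s :: complex assume "norm (of_nat d - s) = 1 / L"
      then have s: "norm (s - of_nat d) = 1 / L" by (simp add: norm_minus_commute)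
      have "norm (exp (- ((s - of_nat d) * of_real L))) \<le> exp (norm (- ((s - of_nat d) * of_real L)))"
        by (rule norm_exp)
      also have "norm (- ((s - of_nat d) * of_real L)) = 1" using s L by (simp add: norm_mult)
      finally have "norm (exp (- ((s - of_nat d) * of_real L))) * C / real n \<le> exp 1 * C / real n"
        using C0 by (intro divide_right_mono mult_right_mono) auto
      with C[OF n(2,1), of s] show "norm (F s - H s) \<le> exp 1 * C / real n"
        using s r by (simp add: F_def H_def L_def)
    qed
    also have "(deriv ^^ (d - 1)) (\<lambda>s. F s - H s) (of_nat d) =
        (deriv ^^ (d - 1)) F (of_nat d) - (deriv ^^ (d - 1)) H (of_nat d)"
      using assms by (intro higher_deriv_diff[OF hol open_halfspace_Re_gt]) auto
    finally have *: "norm ((deriv ^^ (d - 1)) F (of_nat d) - (deriv ^^ (d - 1)) H (of_nat d)) \<le>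
        fact (d - 1) * (exp 1 * C * (L ^ (d - 1) / real n))"
      by (simp add: power_one_over)
    let ?S = "L ^ (d - 1) * (\<Sum>j = 0..d - 1. (-1) ^ j * (deriv ^^ j) (Gamma :: real \<Rightarrow> real) (real d)
                 / (fact j * fact (d - 1 - j)) / L ^ j)"
    \<comment> \<open>Both terms carry the same prefactor, whose \<open>1 / fact (d - 1)\<close>
      cancels the factorial from Cauchy's inequality.\<close>
    have "complex_of_real (expected_interior_generators d n - ?S) = (-1) ^ (d - 1) / fact (d - 1) *
        ((deriv ^^ (d - 1)) F (of_nat d) - (deriv ^^ (d - 1)) H (of_nat d))"
      using expected_interior_generators_eq_higher_deriv[OF assms n(1)]
        higher_deriv_Gamma_mult_exp[OF assms, of L] L
      by (simp only: of_real_diff right_diff_distrib F_def[abs_def] H_def[abs_def])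
    then have "norm (complex_of_real (expected_interior_generators d n - ?S)) =
        norm ((deriv ^^ (d - 1)) F (of_nat d) - (deriv ^^ (d - 1)) H (of_nat d)) / fact (d - 1)"
      by (simp only: norm_mult norm_divide norm_power) simp
    also have "\<dots> \<le> exp 1 * C * (L ^ (d - 1) / real n)"
      using * by (simp add: divide_le_eq mult.commute)
    finally show ?case using L by (simp only: norm_of_real) (simp add: L_def)
  qed
  then show ?thesis by (rule bigoI)
qed

end
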